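(* Let $K$ be a cell of size $h$ cut by a plane parallel to a face, with inside part a slab of relative thickness $\kappa\in(0,1)$ measured from the ghost face $F$ opposite the interface, an uncut neighbour $K'$ across $F$, and the boundary segment $\Gamma\cap K$ parallel to $F$. Let $A_\ell^{(2)}$ denote the corresponding two-cell form (written out in the context), containing the physical and Nitsche terms on these cells and the ghost penalty on the single face $F$. (i) (visibility scale) For the mode $\xi(x)=c\,x^p\in\mathbb Q_p(K)$, with $x$ the distance to $F$, normalized to unit full-cell energy ($c^2=(2p-1)/p^2$; tangential directions integrate out), the physical energy is $|\xi|^2_{1,K\cap\Omega}=\kappa^{2p-1}$ and the ghost energy is $\gamma c^2$. The two are comparable at $$\gamma_{\mathrm{vis}}(p,\kappa)\;\simeq\;\frac{p^2}{2p-1}\,\kappa^{\,2p-1},$$ the weight below which the penalty is spectrally negligible against the physical energy on this mode and above which it dominates it. (ii) (coercivity obstruction) For the piecewise $\mathbb Q_1$ function $v_\kappa$ that vanishes on the neighbour $K'$ and equals the distance to $F$ on $K$, $$A_\ell^{(2)}(v_\kappa,v_\kappa)=\bigl(\gamma-\kappa+\gamma_D\kappa^2\bigr)\,h^d,$$ so, for $\gamma_D>\tfrac12$, nonnegativity of the model form, uniformly over the cut fraction, requires $$\gamma\;\ge\;\max_{\kappa\in(0,1)}\kappa\,(1-\gamma_D\kappa)\;=\;\frac{1}{4\gamma_D},$$ attained at the moderate cut fraction $\kappa=1/(2\gamma_D)$, a floor of order $p^{-2}$ at the standard Nitsche scaling $\gamma_D\simeq Cp^2$. (iii) (incompatibility)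 At the standard scaling $\gamma_D\simeq Cp^2$ and for any fixed $\kappa\in(0,1)$, $$\frac{\gamma_{\mathrm{vis}}(p,\kappa)}{1/(4\gamma_D)}\;\lesssim\;p^{3}\,\kappa^{\,2p-1}\;\longrightarrow\;0\qquad(p\to\infty):$$ no global multiplier $\gamma$ reaches the visibility scale of the degree-$p$ mode while retaining cut-uniform nonnegativity of the two-cell form.
   Context: Two-cell configuration. $K\subset\mathbb R^d$ is an axis-parallel cube of edge $h$; $\Omega$ is the physical domain with boundary $\Gamma$. The physical part $K\cap\Omega$ is the slab of points of $K$ at distance less than $\kappa h$ from the face $F$; $\kappa\in(0,1)$ is the cut fraction; $\Gamma\cap K$ is the cross-section of $K$ at distance $\kappa h$ from $F$. $K'$ is the neighbouring cube of edge $h$ across $F$, contained in $\Omega$. $\mathbb Q_p$ denotes polynomials of degree at most $p$ in each variable separately, $p\ge1$. Two-cell form, for functions continuous on $K\cup K'$ and in $\mathbb Q_p$ on each cell: $$A_\ell^{(2)}(u,v)=(\nabla u,\nabla v)_{K'\cup(K\cap\Omega)}-(\partial_nu,v)_{\Gamma\cap K}-(u,\partial_nv)_{\Gamma\cap K}+\gamma_Dh^{-1}(u,v)_{\Gamma\cap K}+\gamma\sum_{k=1}^p\frac{h^{2k-1}}{(k!)^2}\bigl(\llbracket\partial_n^ku\rrbracket,\llbracket\partial_n^kv\rrbracket\bigr)_F .$$ Here $(\cdot,\cdot)_X$ is the $L^2(X)$ inner product; on $\Gamma\cap K$, $n$ is the unit normal pointing out of $\Omega$; on $F$, $n$ is a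 fixed unit normal and $\llbracket\cdot\rrbracket$ the jump across $F$. $\gamma_D$ is the Nitsche penalty parameter and $\gamma\in(0,1]$ the global ghost-penalty weight (the "global multiplier"). The last term is the ghost penalty; its value at $u=v$ is the ghost energy. $|\cdot|_{1,X}=\|\nabla\cdot\|_{L^2(X)}$. "Cut-uniform" means uniformly over $\kappa\in(0,1)$. In (i) lengths are scaled so that $h=1$ and the mode is extended by zero to $K'$. $C$ denotes a constant independent of $p$, and $\simeq$, $\lesssim$ mean up to constants independent of $p$. *)

theory Defs
  imports "HOL-Analysis.Analysis"
begin

text \<open>
  Geometry. The cell \<open>K\<close> is \<open>cube z h\<close> (centre \<open>z\<close>, edge \<open>h\<close>). The vector \<open>\<nu>\<close> is always plus or minus
  a coordinate vector. The ghost face \<open>F\<close> is the face of \<open>K\<close> whose normal pointing into \<open>K\<close> is \<open>\<nu>\<close>,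
  so \<open>\<nu>\<close> points from the neighbour \<open>K'\<close> into \<open>K\<close>, and on \<open>\<Gamma> \<inter> K\<close> it is the unit normal pointing out
  of \<open>\<Omega>\<close>. On \<open>F\<close> we also use \<open>\<nu>\<close> as the fixed unit normal; its sign, and the sign of the jump, do not
  affect products of two jumps.
\<close>

definition cube :: "'a::euclidean_space \<Rightarrow> real \<Rightarrow> 'a set" where
  "cube z h = cbox (z - (h / 2) *\<^sub>R One) (z + (h / 2) *\<^sub>R One)"

definition neighbour :: "'a::euclidean_space \<Rightarrow> real \<Rightarrow> 'a \<Rightarrow> 'a set" where
  "neighbour z h \<nu> = cube (z - h *\<^sub>R \<nu>) h"

definition ghost_face :: "'a::euclidean_space \<Rightarrow> real \<Rightarrow> 'a \<Rightarrow> 'a set" where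
  "ghost_face z h \<nu> = {x \<in> cube z h. x \<bullet> \<nu> = z \<bullet> \<nu> - h / 2}"

text \<open>The sets \<open>K \<inter> \<Omega>\<close> and \<open>\<Gamma> \<inter> K\<close>, through which alone the two-cell form sees the cut.\<close>

definition physical_part :: "'a::euclidean_space \<Rightarrow> real \<Rightarrow> 'a \<Rightarrow> real \<Rightarrow> 'a set" where
  "physical_part z h \<nu> \<kappa> = {x \<in> cube z h. infdist x (ghost_face z h \<nu>) < \<kappa> * h}"

definition cut_boundary :: "'a::euclidean_space \<Rightarrow> real \<Rightarrow> 'a \<Rightarrow> real \<Rightarrow> 'a set" where
  "cut_boundary z h \<nu> \<kappa> = {x \<in> cube z h. infdist x (ghost_face z h \<nu>) = \<kappa> * h}"

text \<open>
  The \<open>(d-1)\<close>-dimensional Lebesgue measure carried by the axis-parallel hyperplane \<open>x \<bullet> \<nu> = t\<close>: the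
  image of the product measure in the tangential coordinates. For \<open>d = 1\<close> it is a unit point mass.
\<close>

definition plane_measure :: "'a::euclidean_space \<Rightarrow> real \<Rightarrow> 'a measure" where
  "plane_measure \<nu> t =
     distr (\<Pi>\<^sub>M b\<in>{b \<in> Basis. b \<bullet> \<nu> = 0}. lborel) borel
       (\<lambda>y. t *\<^sub>R \<nu> + (\<Sum>b\<in>{b \<in> Basis. b \<bullet> \<nu> = 0}. y b *\<^sub>R b))"

abbreviation face_measure :: "'a::euclidean_space \<Rightarrow> real \<Rightarrow> 'a \<Rightarrow> 'a measure" where
  "face_measure z h \<nu> \<equiv> plane_measure \<nu> (z \<bullet> \<nu> - h / 2)"

abbreviation cut_measure :: "'a::euclidean_space \<Rightarrow> real \<Rightarrow> 'a \<Rightarrow> real \<Rightarrow> 'a measure" where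
  "cut_measure z h \<nu> \<kappa> \<equiv> plane_measure \<nu> (z \<bullet> \<nu> - h / 2 + \<kappa> * h)"

definition Qpoly :: "nat \<Rightarrow> ('a::euclidean_space \<Rightarrow> real) set" where
  "Qpoly p = {q. \<exists>c. \<forall>x. q x =
     (\<Sum>\<alpha>\<in>Basis \<rightarrow>\<^sub>E {..p}. c \<alpha> * (\<Prod>b\<in>Basis. (x \<bullet> b) ^ \<alpha> b))}"

definition two_cell_space :: "'a::euclidean_space \<Rightarrow> real \<Rightarrow> 'a \<Rightarrow> nat \<Rightarrow> ('a \<Rightarrow> real) set" where
  "two_cell_space z h \<nu> p = {u. continuous_on (cube z h \<union> neighbour z h \<nu>) u \<and>
     (\<exists>q\<in>Qpoly p. \<forall>x\<in>cube z h. u x = q x) \<and>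
     (\<exists>q\<in>Qpoly p. \<forall>x\<in>neighbour z h \<nu>. u x = q x)}"

text \<open>
  Cellwise derivatives. Differentiating \<^emph>\<open>within\<close> the closed cell \<open>C\<close> gives the usual derivative at
  interior points and the trace from \<open>C\<close> (the one-sided derivative) on the faces of \<open>C\<close>.
\<close>

definition cell_grad :: "'a::euclidean_space set \<Rightarrow> ('a \<Rightarrow> real) \<Rightarrow> 'a \<Rightarrow> 'a" where
  "cell_grad C u x = (\<Sum>b\<in>Basis. frechet_derivative u (at x within C) b *\<^sub>R b)"

definition normal_deriv :: "'a::euclidean_space set \<Rightarrow> 'a \<Rightarrow> ('a \<Rightarrow> real) \<Rightarrow> 'a \<Rightarrow> real" where
  "normal_deriv C \<nu> u x = frechet_derivative u (at x within C) \<nu>"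

definition jump_normal_deriv ::
    "'a::euclidean_space \<Rightarrow> real \<Rightarrow> 'a \<Rightarrow> nat \<Rightarrow> ('a \<Rightarrow> real) \<Rightarrow> 'a \<Rightarrow> real" where
  "jump_normal_deriv z h \<nu> k u x =
     (normal_deriv (cube z h) \<nu> ^^ k) u x - (normal_deriv (neighbour z h \<nu>) \<nu> ^^ k) u x"

text \<open>The \<open>H\<^sup>1\<close> seminorm \<open>|u|\<^sub>1\<^sub>,\<^sub>X\<close> on a part \<open>X\<close> of the cell \<open>C\<close>.\<close>

definition h1_seminorm :: "'a::euclidean_space set \<Rightarrow> 'a set \<Rightarrow> ('a \<Rightarrow> real) \<Rightarrow> real" where
  "h1_seminorm C X u = sqrt (LINT x:X|lborel. (norm (cell_grad C u x))\<^sup>2)"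

definition ghost_penalty ::
    "'a::euclidean_space \<Rightarrow> real \<Rightarrow> 'a \<Rightarrow> nat \<Rightarrow> real \<Rightarrow> ('a \<Rightarrow> real) \<Rightarrow> ('a \<Rightarrow> real) \<Rightarrow> real" where
  "ghost_penalty z h \<nu> p \<gamma> u v =
     \<gamma> * (\<Sum>k=1..p. h ^ (2 * k - 1) / (fact k)\<^sup>2 *
       (LINT x:ghost_face z h \<nu>|face_measure z h \<nu>.
          jump_normal_deriv z h \<nu> k u x * jump_normal_deriv z h \<nu> k v x))"

text \<open>
  The integral over \<open>K' \<union> (K \<inter> \<Omega>)\<close> is split into its two cells, which overlap only in the null set \<open>F\<close>.
\<close>

definition two_cell_form ::
    "'a::euclidean_space \<Rightarrow> real \<Rightarrow> 'a \<Rightarrow> real \<Rightarrow> nat \<Rightarrow> real \<Rightarrow> real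
       \<Rightarrow> ('a \<Rightarrow> real) \<Rightarrow> ('a \<Rightarrow> real) \<Rightarrow> real" where
  "two_cell_form z h \<nu> \<kappa> p \<gamma>D \<gamma> u v =
     (let K = cube z h; K' = neighbour z h \<nu>;
          G = cut_boundary z h \<nu> \<kappa>; \<sigma> = cut_measure z h \<nu> \<kappa>
      in (LINT x:K'|lborel. cell_grad K' u x \<bullet> cell_grad K' v x)
         + (LINT x:physical_part z h \<nu> \<kappa>|lborel. cell_grad K u x \<bullet> cell_grad K v x)
         - (LINT x:G|\<sigma>. normal_deriv K \<nu> u x * v x)
         - (LINT x:G|\<sigma>. u x * normal_deriv K \<nu> v x)
         + \<gamma>D / h * (LINT x:G|\<sigma>. u x * v x)
         + ghost_penalty z h \<nu> p \<gamma> u v)"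

definition cut_uniformly_nonneg ::
    "'a::euclidean_space \<Rightarrow> real \<Rightarrow> 'a \<Rightarrow> nat \<Rightarrow> real \<Rightarrow> real \<Rightarrow> bool" where
  "cut_uniformly_nonneg z h \<nu> p \<gamma>D \<gamma> \<longleftrightarrow>
     (\<forall>\<kappa>\<in>{0<..<1}. \<forall>v\<in>two_cell_space z h \<nu> p. two_cell_form z h \<nu> \<kappa> p \<gamma>D \<gamma> v v \<ge> 0)"

text \<open>The mode \<open>c x\<^sup>p\<close> (for \<open>h = 1\<close>) and the function \<open>v\<^sub>\<kappa>\<close>, both extended by zero outside \<open>K\<close>.\<close>

definition power_mode :: "'a::euclidean_space \<Rightarrow> 'a \<Rightarrow> nat \<Rightarrow> real \<Rightarrow> 'a \<Rightarrow> real" where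
  "power_mode z \<nu> p c x = (if x \<in> cube z 1 then c * infdist x (ghost_face z 1 \<nu>) ^ p else 0)"

definition distance_fun :: "'a::euclidean_space \<Rightarrow> real \<Rightarrow> 'a \<Rightarrow> 'a \<Rightarrow> real" where
  "distance_fun z h \<nu> x = (if x \<in> cube z h then infdist x (ghost_face z h \<nu>) else 0)"

text \<open>Bounds up to constants independent of the polynomial degree \<open>p \<ge> 1\<close>.\<close>

definition lesssim :: "(nat \<Rightarrow> real) \<Rightarrow> (nat \<Rightarrow> real) \<Rightarrow> bool"  (infix "\<lesssim>" 50) where
  "f \<lesssim> g \<longleftrightarrow> (\<exists>M>0. \<forall>p\<ge>1. f p \<le> M * g p)"

definition simeq :: "(nat \<Rightarrow> real) \<Rightarrow> (nat \<Rightarrow> real) \<Rightarrow> bool"  (infix "\<simeq>" 50) where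
  "f \<simeq> g \<longleftrightarrow> f \<lesssim> g \<and> g \<lesssim> f"

text \<open>
  A family of weights \<open>g p\<close> is a visibility scale at the cut fraction \<open>\<kappa>\<close> if, with the weight \<open>g p\<close>,
  ghost energy and physical energy of the degree-\<open>p\<close> mode of unit full-cell energy are comparable.
  The factor \<open>c p\<close> is determined by the normalization up to its sign.
\<close>

definition visibility_scale :: "'a::euclidean_space \<Rightarrow> 'a \<Rightarrow> real \<Rightarrow> (nat \<Rightarrow> real) \<Rightarrow> bool" where
  "visibility_scale z \<nu> \<kappa> g \<longleftrightarrow>
     (\<forall>c. (\<forall>p\<ge>1. (h1_seminorm (cube z 1) (cube z 1) (power_mode z \<nu> p (c p)))\<^sup>2 = 1) \<longrightarrow>
       (\<lambda>p. ghost_penalty z 1 \<nu> p (g p) (power_mode z \<nu> p (c p)) (power_mode z \<nu> p (c p)))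
         \<simeq> (\<lambda>p. (h1_seminorm (cube z 1) (physical_part z 1 \<nu> \<kappa>) (power_mode z \<nu> p (c p)))\<^sup>2))"

end

theory Submission
  imports Defs
begin

text \<open>
  Both test functions of the statement are a monomial \<open>c * t ^ n\<close> with \<open>n \<ge> 1\<close> in the height
  \<open>t = x \<bullet> \<nu> - (z \<bullet> \<nu> - h / 2)\<close> over the ghost face on the cut cell, and zero on the neighbour. On the
  cell the distance to the face equals \<open>t\<close> (\<open>infdist_ghost_face\<close>), so every term of the two-cell form
  becomes a one-dimensional computation times the area \<open>h ^ (d - 1)\<close> of a cross-section:

  \<^item> the gradient is \<open>c n t ^ (n - 1) \<nu>\<close>, so Fubini turns the energy on a slab of thickness \<open>r\<close> into
    \<open>c\<^sup>2 n\<^sup>2 / (2 n - 1) * r ^ (2 n - 1)\<close> (\<open>integral_grad_power\<close>);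
  \<^item> the \<open>k\<close>-th normal derivative at height zero vanishes unless \<open>k = n\<close>, where it is \<open>c n!\<close>, so exactly
    one summand of the ghost penalty survives and the weight \<open>1 / (k!)\<^sup>2\<close> cancels its factorial
    (\<open>ghost_penalty_power\<close>);
  \<^item> the integrands on the cut boundary are constant.

  For the mode of degree \<open>p\<close> the energies therefore have the ratio \<open>\<gamma> / \<gamma>\<^sub>v\<^sub>i\<^sub>s\<close> with
  \<open>\<gamma>\<^sub>v\<^sub>i\<^sub>s = p\<^sup>2 / (2 p - 1) * \<kappa> ^ (2 p - 1)\<close>. For the distance function the energy \<open>\<kappa>\<close>, the two
  consistency terms \<open>- \<kappa>\<close> each, the penalty \<open>\<gamma>D \<kappa>\<^sup>2\<close> and the ghost energy \<open>\<gamma>\<close>, all in units of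
  \<open>h ^ d\<close>, add up to \<open>\<gamma> - \<kappa> + \<gamma>D \<kappa>\<^sup>2\<close>. Its minimum over the cut fraction is at
  \<open>\<kappa> = 1 / (2 \<gamma>D)\<close>, which lies in the open unit interval because \<open>\<gamma>D > 1 / 2\<close>, and nonnegativity there is
  \<open>\<gamma> \<ge> 1 / (4 \<gamma>D)\<close> (\<open>cut_uniformly_nonneg_floor\<close>).

  With \<open>\<gamma>D\<close> of order \<open>p\<^sup>2\<close> this floor decays only like \<open>p ^ (- 2)\<close>, whereas the visibility scale decays
  geometrically. Their quotient is of order at most \<open>p ^ 3 * \<kappa> ^ (2 p - 1)\<close> and tends to zero
  (\<open>visibility_floor_ratio\<close>), so a weight bounded by a fixed multiple of the visibility scale eventually
  lies below the floor.
\<close>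

section \<open>The height over the ghost face\<close>

lemma signed_basisE:
  fixes \<nu> :: "'a::euclidean_space"
  assumes "\<nu> \<in> Basis \<or> - \<nu> \<in> Basis"
  obtains \<beta> \<sigma> where "\<beta> \<in> Basis" "\<sigma> = 1 \<or> \<sigma> = - 1" "\<nu> = \<sigma> *\<^sub>R \<beta>"
  using assms that[of "\<nu>" 1] that[of "-\<nu>" "-1"] by auto

lemma signed_basis_inner_self:
  fixes \<nu> :: "'a::euclidean_space"
  assumes "\<nu> \<in> Basis \<or> - \<nu> \<in> Basis"
  shows "\<nu> \<bullet> \<nu> = 1"
  using assms by (elim signed_basisE) (auto simp: inner_Basis)

lemma mem_cube:
  "x \<in> cube z h \<longleftrightarrow> (\<forall>b\<in>Basis. z \<bullet> b - h / 2 \<le> x \<bullet> b \<and> x \<bullet> b \<le> z \<bullet> b + h / 2)"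
  by (auto simp: cube_def mem_box inner_diff_left inner_add_left)

lemma height_bounds:
  fixes \<nu> :: "'a::euclidean_space"
  assumes "\<nu> \<in> Basis \<or> - \<nu> \<in> Basis" "x \<in> cube z h"
  shows "0 \<le> x \<bullet> \<nu> - (z \<bullet> \<nu> - h / 2)" "x \<bullet> \<nu> - (z \<bullet> \<nu> - h / 2) \<le> h"
  using bspec[OF assms(2)[unfolded mem_cube], of \<nu>]
    bspec[OF assms(2)[unfolded mem_cube], of "- \<nu>"] assms(1) by auto

lemma height_nonpos_neighbour:
  fixes \<nu> :: "'a::euclidean_space"
  assumes "\<nu> \<in> Basis \<or> - \<nu> \<in> Basis" "x \<in> neighbour z h \<nu>"
  shows "x \<bullet> \<nu> - (z \<bullet> \<nu> - h / 2) \<le> 0"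
  using height_bounds(2)[of \<nu> x "z - h *\<^sub>R \<nu>" h] assms
  by (simp add: neighbour_def inner_diff_left signed_basis_inner_self)

text \<open>
  The foot of the perpendicular from \<open>x\<close> attains the height and lies in the cell, because only the one
  coordinate along \<open>\<nu>\<close> changes. No point of the face is closer, by the Cauchy--Schwarz inequality
  applied to the unit vector \<open>\<nu>\<close>.
\<close>

lemma infdist_ghost_face:
  fixes \<nu> :: "'a::euclidean_space"
  assumes \<nu>: "\<nu> \<in> Basis \<or> - \<nu> \<in> Basis" and x: "x \<in> cube z h"
  shows "infdist x (ghost_face z h \<nu>) = x \<bullet> \<nu> - (z \<bullet> \<nu> - h / 2)"
proof -
  define t where "t = x \<bullet> \<nu> - (z \<bullet> \<nu> - h / 2)"
  define y where "y = x - t *\<^sub>R \<nu>"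
  have t: "0 \<le> t" "t \<le> h" using height_bounds[OF \<nu> x] by (simp_all add: t_def)
  have nn: "\<nu> \<bullet> \<nu> = 1" by (rule signed_basis_inner_self[OF \<nu>])
  obtain \<beta> \<sigma> where b: "\<beta> \<in> Basis" "\<sigma> = 1 \<or> \<sigma> = - 1" "\<nu> = \<sigma> *\<^sub>R \<beta>"
    using \<nu> by (rule signed_basisE)
  have yb: "y \<bullet> b = (if b = \<beta> then z \<bullet> b - \<sigma> * h / 2 else x \<bullet> b)" if "b \<in> Basis" for b
    using b that by (auto simp: y_def t_def inner_diff_left inner_Basis)
  have y: "y \<in> ghost_face z h \<nu>"
  proof -
    have "y \<in> cube z h"
      using x t b by (auto simp: mem_cube yb)
    moreover have "y \<bullet> \<nu> = z \<bullet> \<nu> - h / 2"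
      using nn by (simp add: y_def t_def inner_diff_left)
    ultimately show ?thesis by (simp add: ghost_face_def)
  qed
  have "dist x y = t"
    using t nn by (simp add: y_def dist_norm norm_eq_sqrt_inner)
  then have le: "infdist x (ghost_face z h \<nu>) \<le> t"
    using infdist_le[OF y, of x] by simp
  have "t \<le> dist x w" if "w \<in> ghost_face z h \<nu>" for w
  proof -
    have "t = (x - w) \<bullet> \<nu>" using that by (simp add: ghost_face_def t_def inner_diff_left)
    also have "\<dots> \<le> norm (x - w) * norm \<nu>" by (rule norm_cauchy_schwarz)
    finally show ?thesis using nn by (simp add: dist_norm norm_eq_sqrt_inner)
  qed
  then have "t \<le> infdist x (ghost_face z h \<nu>)"
    using y by (subst infdist_notempty) (auto intro!: cINF_greatest)
  with le show ?thesis by (simp add: t_def)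
qed

section \<open>Height monomials in the discrete space\<close>

text \<open>
  The exponent family of \<open>(x \<bullet> \<beta>) ^ k\<close> is \<open>k\<close> at \<open>\<beta>\<close> and \<open>0\<close> at the other basis vectors; a coefficient
  family supported on these families for \<open>k \<le> p\<close> reproduces \<open>P\<close>.
\<close>

lemma univariate_in_Qpoly:
  fixes \<beta> :: "'a::euclidean_space"
  assumes \<beta>: "\<beta> \<in> Basis" and deg: "degree P \<le> p"
  shows "(\<lambda>x. poly P (x \<bullet> \<beta>)) \<in> Qpoly p"
proof -
  define E :: "nat \<Rightarrow> 'a \<Rightarrow> nat" where "E k = (\<lambda>b\<in>Basis. if b = \<beta> then k else 0)" for k
  define c where "c \<alpha> = (if \<alpha> \<in> E ` {..p} then coeff P (\<alpha> \<beta>) else 0)" for \<alpha>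
  have E\<beta>: "E k \<beta> = k" for k using \<beta> by (simp add: E_def)
  have inj: "inj_on E {..p}" by (metis E\<beta> inj_onI)
  have sub: "E ` {..p} \<subseteq> Basis \<rightarrow>\<^sub>E {..p}" by (auto simp: E_def PiE_iff)
  have "poly P (x \<bullet> \<beta>) = (\<Sum>\<alpha>\<in>Basis \<rightarrow>\<^sub>E {..p}. c \<alpha> * (\<Prod>b\<in>Basis. (x \<bullet> b) ^ \<alpha> b))" for x
  proof -
    have "(\<Prod>b\<in>Basis. (x \<bullet> b) ^ E k b) = (x \<bullet> \<beta>) ^ k" for k
    proof -
      have "(\<Prod>b\<in>Basis. (x \<bullet> b) ^ E k b) = (\<Prod>b\<in>Basis. if b = \<beta> then (x \<bullet> b) ^ k else 1)"
        by (rule prod.cong) (auto simp: E_def)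
      then show ?thesis using \<beta> by (simp add: prod.delta)
    qed
    then have "(\<Sum>k\<le>p. coeff P k * (x \<bullet> \<beta>) ^ k) =
        (\<Sum>\<alpha>\<in>E ` {..p}. c \<alpha> * (\<Prod>b\<in>Basis. (x \<bullet> b) ^ \<alpha> b))"
      by (simp add: sum.reindex[OF inj] c_def E\<beta>)
    also have "\<dots> = (\<Sum>\<alpha>\<in>Basis \<rightarrow>\<^sub>E {..p}. c \<alpha> * (\<Prod>b\<in>Basis. (x \<bullet> b) ^ \<alpha> b))"
      by (rule sum.mono_neutral_left) (use sub in \<open>auto simp: c_def finite_PiE\<close>)
    also have "(\<Sum>k\<le>p. coeff P k * (x \<bullet> \<beta>) ^ k) = poly P (x \<bullet> \<beta>)"
      unfolding poly_altdef
      by (rule sum.mono_neutral_right) (use deg in \<open>auto simp: coeff_eq_0\<close>)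
    finally show ?thesis .
  qed
  then show ?thesis unfolding Qpoly_def by blast
qed

lemma height_power_in_Qpoly:
  fixes \<nu> :: "'a::euclidean_space"
  assumes \<nu>: "\<nu> \<in> Basis \<or> - \<nu> \<in> Basis" and "n \<le> p"
  shows "(\<lambda>x. c * (x \<bullet> \<nu> - a) ^ n) \<in> Qpoly p"
proof -
  obtain \<beta> \<sigma> where b: "\<beta> \<in> Basis" "\<sigma> = 1 \<or> \<sigma> = - 1" "\<nu> = \<sigma> *\<^sub>R \<beta>"
    using \<nu> by (rule signed_basisE)
  define P where "P = smult c ([:- a, \<sigma>:] ^ n)"
  have "degree P \<le> degree [:- a, \<sigma>:] * n"
    unfolding P_def by (meson degree_power_le degree_smult_le le_trans)
  also have "\<dots> \<le> 1 * n" by (intro mult_right_mono) auto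
  finally have "degree P \<le> p" using \<open>n \<le> p\<close> by simp
  from univariate_in_Qpoly[OF b(1) this] show ?thesis
    by (simp add: P_def b(3) poly_power algebra_simps)
qed

text \<open>
  Both cells are closed and \<open>u\<close> is continuous on each of them, so it is continuous on their union: that
  the traces on the common face agree is contained in the two hypotheses on \<open>u\<close>.
\<close>

lemma two_cell_space_power:
  fixes z \<nu> :: "'a::euclidean_space"
  assumes \<nu>: "\<nu> \<in> Basis \<or> - \<nu> \<in> Basis" and "n \<le> p"
    and uK: "\<And>x. x \<in> cube z h \<Longrightarrow> u x = c * (x \<bullet> \<nu> - (z \<bullet> \<nu> - h / 2)) ^ n"
    and uN: "\<And>x. x \<in> neighbour z h \<nu> \<Longrightarrow> u x = 0"
  shows "u \<in> two_cell_space z h \<nu> p"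
proof -
  have "continuous_on (cube z h) u"
    by (subst continuous_on_cong[OF refl uK]) (auto intro!: continuous_intros)
  moreover have "continuous_on (neighbour z h \<nu>) u"
    by (subst continuous_on_cong[OF refl uN]) auto
  ultimately have "continuous_on (cube z h \<union> neighbour z h \<nu>) u"
    by (intro continuous_on_closed_Un) (auto simp: cube_def neighbour_def)
  moreover have "\<exists>q\<in>Qpoly p. \<forall>x\<in>cube z h. u x = q x"
    using height_power_in_Qpoly[OF \<nu> \<open>n \<le> p\<close>] uK by (intro bexI) auto
  moreover have "\<exists>q\<in>Qpoly p. \<forall>x\<in>neighbour z h \<nu>. u x = q x"
    using height_power_in_Qpoly[OF \<nu> \<open>n \<le> p\<close>, of 0 0] uN by (intro bexI) auto
  ultimately show ?thesis by (simp add: two_cell_space_def)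
qed

section \<open>Cellwise derivatives of height monomials\<close>

text \<open>
  The cell is a box with nonempty interior, which makes the derivative within it unique even at boundary
  points, and it only depends on the values of \<open>u\<close> on the cell. The base height \<open>a\<close> is arbitrary, so that
  the case \<open>c = 0\<close> also covers the neighbour cell.
\<close>

lemma frechet_derivative_cell_power:
  fixes z \<nu> :: "'a::euclidean_space"
  assumes "h > 0" and x: "x \<in> cube z h"
    and u: "\<And>y. y \<in> cube z h \<Longrightarrow> u y = c * (y \<bullet> \<nu> - a) ^ n"
  shows "frechet_derivative u (at x within cube z h)
           = (\<lambda>v. c * real n * (x \<bullet> \<nu> - a) ^ (n - 1) * (v \<bullet> \<nu>))"
proof -
  have "((\<lambda>y. c * (y \<bullet> \<nu> - a) ^ n) has_derivative
          (\<lambda>v. c * real n * (x \<bullet> \<nu> - a) ^ (n - 1) * (v \<bullet> \<nu>))) (at x within cube z h)"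
    by (auto intro!: derivative_eq_intros simp: algebra_simps)
  then have "(u has_derivative
          (\<lambda>v. c * real n * (x \<bullet> \<nu> - a) ^ (n - 1) * (v \<bullet> \<nu>))) (at x within cube z h)"
    by (rule has_derivative_transform[OF x, rotated]) (simp add: u)
  then show ?thesis
    using x \<open>h > 0\<close> unfolding cube_def
    by (intro frechet_derivative_within_cbox) (auto simp: inner_diff_left inner_add_left)
qed

lemma cell_grad_power:
  fixes z \<nu> :: "'a::euclidean_space"
  assumes "h > 0" and "x \<in> cube z h"
    and "\<And>y. y \<in> cube z h \<Longrightarrow> u y = c * (y \<bullet> \<nu> - a) ^ n"
  shows "cell_grad (cube z h) u x = (c * real n * (x \<bullet> \<nu> - a) ^ (n - 1)) *\<^sub>R \<nu>"
proof -
  have D: "frechet_derivative u (at x within cube z h)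
      = (\<lambda>v. c * real n * (x \<bullet> \<nu> - a) ^ (n - 1) * (v \<bullet> \<nu>))"
    by (rule frechet_derivative_cell_power[OF assms(1,2)]) (rule assms(3))
  have "cell_grad (cube z h) u x
      = (c * real n * (x \<bullet> \<nu> - a) ^ (n - 1)) *\<^sub>R (\<Sum>b\<in>Basis. (\<nu> \<bullet> b) *\<^sub>R b)"
    by (simp add: cell_grad_def D scaleR_sum_right inner_commute)
  then show ?thesis by (simp add: euclidean_representation)
qed

lemma normal_deriv_power:
  fixes z \<nu> :: "'a::euclidean_space"
  assumes "\<nu> \<bullet> \<nu> = 1" "h > 0" "x \<in> cube z h"
    and "\<And>y. y \<in> cube z h \<Longrightarrow> u y = c * (y \<bullet> \<nu> - a) ^ n"
  shows "normal_deriv (cube z h) \<nu> u x = c * real n * (x \<bullet> \<nu> - a) ^ (n - 1)"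
proof -
  have "frechet_derivative u (at x within cube z h)
      = (\<lambda>v. c * real n * (x \<bullet> \<nu> - a) ^ (n - 1) * (v \<bullet> \<nu>))"
    by (rule frechet_derivative_cell_power[OF assms(2,3)]) (rule assms(4))
  then show ?thesis by (simp add: normal_deriv_def assms(1))
qed

text \<open>
  One normal derivative turns the pair \<open>(c, n)\<close> into \<open>(c n, n - 1)\<close> on the whole cell, hence the induction
  on \<open>k\<close> for all coefficients and exponents at once. At \<open>n = 0\<close> the truncated exponent \<open>n - 1\<close> is harmless
  because the coefficient has become zero.
\<close>

lemma iterated_normal_deriv_power_at_zero:
  fixes z \<nu> :: "'a::euclidean_space"
  assumes "\<nu> \<bullet> \<nu> = 1" "h > 0" "x \<in> cube z h" "x \<bullet> \<nu> = a"
    and "\<And>y. y \<in> cube z h \<Longrightarrow> u y = c * (y \<bullet> \<nu> - a) ^ n"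
  shows "(normal_deriv (cube z h) \<nu> ^^ k) u x = (if k = n then c * fact n else 0)"
  using assms(5)
proof (induction k arbitrary: u c n)
  case 0
  then show ?case using assms(3,4) by (simp add: power_0_left)
next
  case (Suc k)
  have "(normal_deriv (cube z h) \<nu> ^^ k) (normal_deriv (cube z h) \<nu> u) x
      = (if k = n - 1 then c * real n * fact (n - 1) else 0)"
    by (rule Suc.IH) (rule normal_deriv_power[OF assms(1,2) _ Suc.prems])
  then show ?case by (cases n) (simp_all add: funpow_Suc_right del: funpow.simps)
qed

lemma jump_normal_deriv_power:
  fixes z \<nu> :: "'a::euclidean_space"
  assumes \<nu>: "\<nu> \<in> Basis \<or> - \<nu> \<in> Basis" and "h > 0" and x: "x \<in> ghost_face z h \<nu>"
    and uK: "\<And>x. x \<in> cube z h \<Longrightarrow> u x = c * (x \<bullet> \<nu> - (z \<bullet> \<nu> - h / 2)) ^ n"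
    and uN: "\<And>x. x \<in> neighbour z h \<nu> \<Longrightarrow> u x = 0"
  shows "jump_normal_deriv z h \<nu> k u x = (if k = n then c * fact n else 0)"
proof -
  have nn: "\<nu> \<bullet> \<nu> = 1" by (rule signed_basis_inner_self[OF \<nu>])
  obtain \<beta> \<sigma> where b: "\<beta> \<in> Basis" "\<sigma> = 1 \<or> \<sigma> = - 1" "\<nu> = \<sigma> *\<^sub>R \<beta>"
    using \<nu> by (rule signed_basisE)
  have xK: "x \<in> cube z h" and xa: "x \<bullet> \<nu> = z \<bullet> \<nu> - h / 2"
    using x by (simp_all add: ghost_face_def)
  have "x \<in> neighbour z h \<nu>"
    using xK xa b by (auto simp: neighbour_def mem_cube inner_diff_left inner_Basis)
  \<comment> \<open>On the neighbour \<open>u\<close> is the monomial with coefficient \<open>0\<close> and exponent \<open>0\<close>.\<close>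
  then have "(normal_deriv (neighbour z h \<nu>) \<nu> ^^ k) u x = (if k = 0 then 0 * fact 0 else 0)"
    using uN nn \<open>h > 0\<close> unfolding neighbour_def
    by (intro iterated_normal_deriv_power_at_zero[where a = "x \<bullet> \<nu>"]) auto
  then show ?thesis
    using iterated_normal_deriv_power_at_zero[OF nn \<open>h > 0\<close> xK xa uK]
    by (simp add: jump_normal_deriv_def)
qed

section \<open>Integrals over slabs and cross-sections\<close>

lemma integral_lborel_prod_Basis:
  fixes f :: "'a::euclidean_space \<Rightarrow> real \<Rightarrow> real"
  assumes "\<And>b. b \<in> Basis \<Longrightarrow> integrable lborel (f b)"
  shows "(\<integral>x. (\<Prod>b\<in>Basis. f b (x \<bullet> b)) \<partial>lborel) = (\<Prod>b\<in>Basis. \<integral>s. f b s \<partial>lborel)"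
proof -
  interpret product_sigma_finite "\<lambda>_::'a. lborel :: real measure" ..
  have [measurable]: "f b \<in> borel_measurable borel" if "b \<in> Basis" for b
    using borel_measurable_integrable[OF assms[OF that]] by simp
  have "(\<integral>x. (\<Prod>b\<in>Basis. f b (x \<bullet> b)) \<partial>lborel)
      = (\<integral>y. (\<Prod>b\<in>Basis. f b ((\<Sum>b'\<in>Basis. y b' *\<^sub>R b') \<bullet> b)) \<partial>(\<Pi>\<^sub>M b\<in>(Basis::'a set). lborel))"
    by (subst lborel_eq) (subst integral_distr; measurable)
  also have "\<dots> = (\<integral>y. (\<Prod>b\<in>Basis. f b (y b)) \<partial>(\<Pi>\<^sub>M b\<in>(Basis::'a set). lborel))"
    by (intro Bochner_Integration.integral_cong prod.cong refl) simp
  also have "\<dots> = (\<Prod>b\<in>Basis. \<integral>s. f b s \<partial>lborel)"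
    by (rule product_integral_prod) (auto intro: assms)
  finally show ?thesis .
qed

text \<open>
  The physical part of the cell is a half-open slab and the full cell a closed one; the interval
  \<open>I\<close> covers both, the difference being a null set.
\<close>

lemma integral_power_half_open_or_closed:
  assumes "0 \<le> r" and I: "I = {0..<r} \<or> I = {0..r}"
  shows "integrable lborel (\<lambda>s. indicator I s * s ^ m)"
    and "(\<integral>s. indicator I s * s ^ m \<partial>lborel) = r ^ Suc m / Suc m"
proof -
  let ?f = "\<lambda>s::real. s ^ m * indicator {0..r} s"
  have m: "(\<lambda>s. indicator I s * s ^ m) \<in> borel_measurable lborel"
    using I by auto
  have ae: "AE s in lborel. ?f s = indicator I s * s ^ m"
    using AE_lborel_singleton[of r] by eventually_elim (use I in \<open>auto split: split_indicator\<close>)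
  have int: "integrable lborel ?f"
    using borel_integrable_atLeastAtMost[of 0 r "\<lambda>s. s ^ m"] 
    by (simp add: set_integrable_def mult.commute)
  then show "integrable lborel (\<lambda>s. indicator I s * s ^ m)"
    using integrable_cong_AE[OF _ m ae] by auto
  have "(\<integral>s. indicator I s * s ^ m \<partial>lborel) = (\<integral>s. ?f s \<partial>lborel)"
    by (rule integral_cong_AE[OF m]) (use ae in auto)
  then show "(\<integral>s. indicator I s * s ^ m \<partial>lborel) = r ^ Suc m / Suc m"
    using integral_power[of 0 r m] \<open>0 \<le> r\<close> by simp
qed

text \<open>
  The slab is a product set and the integrand depends on the coordinate along \<open>\<nu>\<close> alone, so the integral
  is a product of one-dimensional integrals. The hypothesis \<open>r \<le> h\<close> makes the slab condition imply the
  cell's own bounds in that coordinate.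
\<close>

lemma integral_slab_power:
  fixes z \<nu> :: "'a::euclidean_space"
  assumes \<nu>: "\<nu> \<in> Basis \<or> - \<nu> \<in> Basis" and "0 \<le> r" "r \<le> h"
    and I: "I = {0..<r} \<or> I = {0..r}" and a: "a = z \<bullet> \<nu> - h / 2"
  shows "(LINT x:{x \<in> cube z h. x \<bullet> \<nu> - a \<in> I}|lborel. (x \<bullet> \<nu> - a) ^ m)
    = h ^ (DIM('a) - 1) * (r ^ Suc m / Suc m)"
proof -
  obtain \<beta> \<sigma> where b: "\<beta> \<in> Basis" "\<sigma> = 1 \<or> \<sigma> = - 1" "\<nu> = \<sigma> *\<^sub>R \<beta>"
    using \<nu> by (rule signed_basisE)
  have sig: "\<sigma> \<noteq> 0" "\<sigma> * \<sigma> = 1" "\<bar>\<sigma>\<bar> = 1" using b(2) by auto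
  define \<phi> :: "real \<Rightarrow> real" where "\<phi> s = indicator I s * s ^ m" for s
  \<comment> \<open>The one-dimensional factors; a sign \<open>\<sigma> = -1\<close> reflects the one along \<open>\<beta>\<close>.\<close>
  define f where "f b s = (if b = \<beta> then \<phi> (\<sigma> * s - a)
      else indicator {z \<bullet> b - h / 2..z \<bullet> b + h / 2} s)" for b s
  have \<phi>: "integrable lborel \<phi>" "(\<integral>s. \<phi> s \<partial>lborel) = r ^ Suc m / Suc m"
    unfolding \<phi>_def using integral_power_half_open_or_closed[OF \<open>0 \<le> r\<close> I] by auto
  have f\<beta>: "integrable lborel (f \<beta>)" "(\<integral>s. f \<beta> s \<partial>lborel) = r ^ Suc m / Suc m"
  proof -
    show "integrable lborel (f \<beta>)"
      using lborel_integrable_real_affine[OF \<phi>(1) sig(1), of "- a"] by (simp add: f_def[abs_def])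
    show "(\<integral>s. f \<beta> s \<partial>lborel) = r ^ Suc m / Suc m"
      using lborel_integral_real_affine[OF sig(1), of \<phi> "- a"] \<phi>(2) sig(3) by (simp add: f_def)
  qed
  have fb: "integrable lborel (f b)" "(\<integral>s. f b s \<partial>lborel) = h" if "b \<noteq> \<beta>" for b
    using that assms(2,3) by (simp_all add: f_def[abs_def] integrable_indicator_iff)
  have slab: "indicator {x \<in> cube z h. x \<bullet> \<nu> - a \<in> I} x * (x \<bullet> \<nu> - a) ^ m
      = (\<Prod>b\<in>Basis. f b (x \<bullet> b))" for x
  proof (cases "x \<bullet> \<nu> - a \<in> I \<and> (\<forall>b\<in>Basis - {\<beta>}. x \<bullet> b \<in> {z \<bullet> b - h / 2..z \<bullet> b + h / 2})")
    case True
    have "x \<bullet> \<nu> - a \<in> {0..h}" using True I \<open>r \<le> h\<close> by auto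
    then have "x \<in> cube z h"
      using True b by (auto simp: mem_cube a)
    then have "indicator {x \<in> cube z h. x \<bullet> \<nu> - a \<in> I} x * (x \<bullet> \<nu> - a) ^ m = \<phi> (x \<bullet> \<nu> - a)"
      using True by (simp add: \<phi>_def)
    also have "\<dots> = f \<beta> (x \<bullet> \<beta>) * (\<Prod>b\<in>Basis - {\<beta>}. f b (x \<bullet> b))"
      using True b(3) by (auto simp: f_def intro!: prod.neutral)
    finally show ?thesis using b(1) by (simp add: prod.remove)
  next
    case False
    have "\<exists>b\<in>Basis. f b (x \<bullet> b) = 0"
    proof (cases "x \<bullet> \<nu> - a \<in> I")
      case True
      with False show ?thesis by (auto simp: f_def)
    next
      case False
      then show ?thesis using b by (intro bexI[of _ \<beta>]) (auto simp: f_def \<phi>_def)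
    qed
    moreover have "x \<notin> {x \<in> cube z h. x \<bullet> \<nu> - a \<in> I}"
      using False by (auto simp: mem_cube)
    ultimately show ?thesis by (simp add: prod_zero)
  qed
  have "(LINT x:{x \<in> cube z h. x \<bullet> \<nu> - a \<in> I}|lborel. (x \<bullet> \<nu> - a) ^ m)
      = (\<Prod>b\<in>Basis. \<integral>s. f b s \<partial>lborel)"
    unfolding set_lebesgue_integral_def real_scaleR_def slab
    by (rule integral_lborel_prod_Basis) (metis f\<beta>(1) fb(1))
  also have "\<dots> = (\<integral>s. f \<beta> s \<partial>lborel) * (\<Prod>b\<in>Basis - {\<beta>}. \<integral>s. f b s \<partial>lborel)"
    using b(1) by (simp add: prod.remove)
  also have "(\<Prod>b\<in>Basis - {\<beta>}. \<integral>s. f b s \<partial>lborel) = (\<Prod>b\<in>Basis - {\<beta>}. h)"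
    by (rule prod.cong) (auto simp: fb)
  finally show ?thesis using b(1) by (simp add: f\<beta> card_Diff_singleton)
qed

text \<open>
  The tangential coordinates of the cross-section range over a product of \<open>d - 1\<close> intervals of length \<open>h\<close>.
  For \<open>d = 1\<close> the product is empty and the measure is \<open>1\<close>.
\<close>

lemma measure_plane_section:
  fixes z \<nu> :: "'a::euclidean_space"
  assumes \<nu>: "\<nu> \<in> Basis \<or> - \<nu> \<in> Basis" and "0 \<le> r" "r \<le> h" and t: "t = z \<bullet> \<nu> - h / 2 + r"
  shows "measure (plane_measure \<nu> t) {x \<in> cube z h. x \<bullet> \<nu> = t} = h ^ (DIM('a) - 1)"
proof -
  interpret product_sigma_finite "\<lambda>_::'a. lborel :: real measure" ..
  obtain \<beta> \<sigma> where b: "\<beta> \<in> Basis" "\<sigma> = 1 \<or> \<sigma> = - 1" "\<nu> = \<sigma> *\<^sub>R \<beta>"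
    using \<nu> by (rule signed_basisE)
  \<comment> \<open>The tangential directions, over which the plane measure is a product.\<close>
  have T: "{b \<in> Basis. b \<bullet> \<nu> = 0} = Basis - {\<beta>}"
    using b by (auto simp: inner_Basis)
  define J where "J b = {z \<bullet> b - h / 2..z \<bullet> b + h / 2}" for b
  define g where "g y = t *\<^sub>R \<nu> + (\<Sum>b\<in>Basis - {\<beta>}. y b *\<^sub>R b)" for y :: "'a \<Rightarrow> real"
  let ?M = "\<Pi>\<^sub>M b\<in>Basis - {\<beta>}. (lborel :: real measure)"
  have g[measurable]: "g \<in> measurable ?M borel" unfolding g_def by measurable
  have S: "{x \<in> cube z h. x \<bullet> \<nu> = t} \<in> sets borel"
    unfolding cube_def by measurable
  have gb: "g y \<bullet> b = (if b = \<beta> then \<sigma> * t else y b)" if "b \<in> Basis" for y b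
  proof -
    have "(\<Sum>b'\<in>Basis - {\<beta>}. y b' *\<^sub>R b') \<bullet> b = (\<Sum>b'\<in>Basis - {\<beta>}. if b' = b then y b' else 0)"
      unfolding inner_sum_left by (rule sum.cong) (use that in \<open>auto simp: inner_Basis\<close>)
    then show ?thesis
      using b that by (auto simp: g_def inner_add_left inner_Basis sum.delta)
  qed
  have pre: "g -` {x \<in> cube z h. x \<bullet> \<nu> = t} \<inter> space ?M = (\<Pi>\<^sub>E b\<in>Basis - {\<beta>}. J b)"
  proof -
    have 1: "g y \<bullet> \<nu> = t" for y using b gb[of \<beta> y] by auto
    have 2: "z \<bullet> \<beta> - h / 2 \<le> \<sigma> * t \<and> \<sigma> * t \<le> z \<bullet> \<beta> + h / 2"
      using b(2,3) assms(2,3) t by auto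
    have "g y \<in> cube z h \<longleftrightarrow> (\<forall>b\<in>Basis - {\<beta>}. y b \<in> J b)" for y
      using 2 by (auto simp: mem_cube gb J_def)
    with 1 show ?thesis by (auto simp: space_PiM PiE_iff)
  qed
  have "measure (plane_measure \<nu> t) {x \<in> cube z h. x \<bullet> \<nu> = t}
      = measure ?M (\<Pi>\<^sub>E b\<in>Basis - {\<beta>}. J b)"
    unfolding plane_measure_def T g_def[symmetric] by (subst measure_distr[OF g S]) (simp only: pre)
  also have "\<dots> = (\<Prod>b\<in>Basis - {\<beta>}. measure lborel (J b))"
  proof -
    have "emeasure ?M (\<Pi>\<^sub>E b\<in>Basis - {\<beta>}. J b) = (\<Prod>b\<in>Basis - {\<beta>}. ennreal h)"
      using assms(2,3) by (subst emeasure_PiM) (auto simp: J_def)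
    then show ?thesis
      using assms(2,3) by (simp add: measure_def J_def prod_ennreal ennreal_power)
  qed
  also have "\<dots> = h ^ (DIM('a) - 1)"
    using assms(2,3) b(1) by (simp add: J_def card_Diff_singleton)
  finally show ?thesis .
qed

lemma integral_const_on_plane_section:
  fixes z \<nu> :: "'a::euclidean_space"
  assumes "\<nu> \<in> Basis \<or> - \<nu> \<in> Basis" "0 \<le> r" "r \<le> h" "t = z \<bullet> \<nu> - h / 2 + r"
    and S: "S = {x \<in> cube z h. x \<bullet> \<nu> = t}" and f: "\<And>x. x \<in> S \<Longrightarrow> f x = C"
  shows "(LINT x:S|plane_measure \<nu> t. f x) = C * h ^ (DIM('a) - 1)"
proof -
  have "(LINT x:S|plane_measure \<nu> t. f x) = (LINT x|plane_measure \<nu> t. indicator S x * C)"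
    unfolding set_lebesgue_integral_def
    by (intro Bochner_Integration.integral_cong) (auto simp: f split: split_indicator)
  also have "\<dots> = measure (plane_measure \<nu> t) S * C"
    by (simp add: plane_measure_def)
  finally show ?thesis using measure_plane_section[OF assms(1-4)] by (simp add: S)
qed

section \<open>Gradient and ghost energy of a height monomial\<close>

lemma integral_grad_power:
  fixes z \<nu> :: "'a::euclidean_space"
  assumes \<nu>: "\<nu> \<in> Basis \<or> - \<nu> \<in> Basis" and "h > 0" "0 \<le> r" "r \<le> h"
    and I: "I = {0..<r} \<or> I = {0..r}"
    and S: "S = {x \<in> cube z h. x \<bullet> \<nu> - (z \<bullet> \<nu> - h / 2) \<in> I}"
    and u: "\<And>x. x \<in> cube z h \<Longrightarrow> u x = c * (x \<bullet> \<nu> - (z \<bullet> \<nu> - h / 2)) ^ n"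
    and "n \<ge> 1"
  shows "(LINT x:S|lborel. cell_grad (cube z h) u x \<bullet> cell_grad (cube z h) u x)
    = c\<^sup>2 * (real n)\<^sup>2 / (2 * real n - 1) * r ^ (2 * n - 1) * h ^ (DIM('a) - 1)"
proof -
  define a where "a = z \<bullet> \<nu> - h / 2"
  \<comment> \<open>The exponent of the height in the squared gradient; \<open>n \<ge> 1\<close> gives \<open>m + 1 = 2 n - 1\<close>.\<close>
  define m where "m = 2 * (n - 1)"
  have m: "real (Suc m) = 2 * real n - 1" "Suc m = 2 * n - 1"
    using \<open>n \<ge> 1\<close> by (auto simp: m_def)
  have "cell_grad (cube z h) u x \<bullet> cell_grad (cube z h) u x
      = c\<^sup>2 * (real n)\<^sup>2 * (x \<bullet> \<nu> - a) ^ m" if "x \<in> S" for x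
  proof -
    have "cell_grad (cube z h) u x = (c * real n * (x \<bullet> \<nu> - a) ^ (n - 1)) *\<^sub>R \<nu>"
      by (rule cell_grad_power[OF \<open>h > 0\<close>]) (use that u in \<open>auto simp: S a_def\<close>)
    then show ?thesis
      by (simp add: signed_basis_inner_self[OF \<nu>] m_def power_mult power2_eq_square
          power_mult_distrib mult_ac)
  qed
  then have "(LINT x:S|lborel. cell_grad (cube z h) u x \<bullet> cell_grad (cube z h) u x)
      = (LINT x:S|lborel. c\<^sup>2 * (real n)\<^sup>2 * (x \<bullet> \<nu> - a) ^ m)"
    unfolding set_lebesgue_integral_def
    by (intro Bochner_Integration.integral_cong) (auto split: split_indicator)
  also have "\<dots> = c\<^sup>2 * (real n)\<^sup>2 * (LINT x:S|lborel. (x \<bullet> \<nu> - a) ^ m)"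
    by (rule set_integral_mult_right)
  also have "(LINT x:S|lborel. (x \<bullet> \<nu> - a) ^ m) = h ^ (DIM('a) - 1) * (r ^ Suc m / Suc m)"
    unfolding S a_def[symmetric] by (rule integral_slab_power[OF \<nu> assms(3,4) I a_def])
  finally show ?thesis unfolding m(1) unfolding m(2) by simp
qed

lemma cube_as_slab:
  fixes z \<nu> :: "'a::euclidean_space"
  assumes "\<nu> \<in> Basis \<or> - \<nu> \<in> Basis"
  shows "cube z h = {x \<in> cube z h. x \<bullet> \<nu> - (z \<bullet> \<nu> - h / 2) \<in> {0..h}}"
proof -
  have "x \<bullet> \<nu> - (z \<bullet> \<nu> - h / 2) \<in> {0..h}" if "x \<in> cube z h" for x
    using height_bounds[OF assms that] by simp
  then show ?thesis by blast
qed

lemma physical_part_as_slab: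
  fixes z \<nu> :: "'a::euclidean_space"
  assumes "\<nu> \<in> Basis \<or> - \<nu> \<in> Basis"
  shows "physical_part z h \<nu> \<kappa> = {x \<in> cube z h. x \<bullet> \<nu> - (z \<bullet> \<nu> - h / 2) \<in> {0..<\<kappa> * h}}"
proof -
  have "infdist x (ghost_face z h \<nu>) < \<kappa> * h \<longleftrightarrow> x \<bullet> \<nu> - (z \<bullet> \<nu> - h / 2) \<in> {0..<\<kappa> * h}"
    if "x \<in> cube z h" for x
    using height_bounds(1)[OF assms that] by (simp add: infdist_ghost_face[OF assms that])
  then show ?thesis unfolding physical_part_def by blast
qed

text \<open>
  On the face only the jump of order \<open>n\<close> is nonzero; it is the constant \<open>c n!\<close>. The range \<open>1 \<le> n \<le> p\<close>
  ensures that this order occurs in the penalty.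
\<close>

lemma ghost_penalty_power:
  fixes z \<nu> :: "'a::euclidean_space"
  assumes \<nu>: "\<nu> \<in> Basis \<or> - \<nu> \<in> Basis" and "h > 0"
    and uK: "\<And>x. x \<in> cube z h \<Longrightarrow> u x = c * (x \<bullet> \<nu> - (z \<bullet> \<nu> - h / 2)) ^ n"
    and uN: "\<And>x. x \<in> neighbour z h \<nu> \<Longrightarrow> u x = 0"
    and n: "1 \<le> n" "n \<le> p"
  shows "ghost_penalty z h \<nu> p \<gamma> u u = \<gamma> * (h ^ (2 * n - 1) * c\<^sup>2 * h ^ (DIM('a) - 1))"
proof -
  have jump: "(LINT x:ghost_face z h \<nu>|face_measure z h \<nu>.
          jump_normal_deriv z h \<nu> k u x * jump_normal_deriv z h \<nu> k u x)
      = (if k = n then c * fact n else 0)\<^sup>2 * h ^ (DIM('a) - 1)" for k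
    by (rule integral_const_on_plane_section[where r = 0 and z = z, OF \<nu>])
      (use \<open>h > 0\<close> in \<open>simp_all add: ghost_face_def[symmetric] power2_eq_square
        jump_normal_deriv_power[OF \<nu> \<open>h > 0\<close> _ uK uN]\<close>)
  have "h ^ (2 * k - 1) / (fact k)\<^sup>2 *
        (LINT x:ghost_face z h \<nu>|face_measure z h \<nu>.
          jump_normal_deriv z h \<nu> k u x * jump_normal_deriv z h \<nu> k u x)
      = (if k = n then h ^ (2 * n - 1) * c\<^sup>2 * h ^ (DIM('a) - 1) else 0)" for k
    unfolding jump by (simp add: power_mult_distrib)
  then have "ghost_penalty z h \<nu> p \<gamma> u u
      = \<gamma> * (\<Sum>k=1..p. if k = n then h ^ (2 * n - 1) * c\<^sup>2 * h ^ (DIM('a) - 1) else 0)"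
    unfolding ghost_penalty_def by (simp only:)
  then show ?thesis using n by (simp add: sum.delta)
qed

section \<open>The two test functions\<close>

lemma power_mode_on_cube:
  fixes z \<nu> :: "'a::euclidean_space"
  assumes "\<nu> \<in> Basis \<or> - \<nu> \<in> Basis" "x \<in> cube z 1"
  shows "power_mode z \<nu> p c x = c * (x \<bullet> \<nu> - (z \<bullet> \<nu> - 1 / 2)) ^ p"
  using assms by (simp add: power_mode_def infdist_ghost_face)

lemma height_zero_on_interface:
  fixes z \<nu> :: "'a::euclidean_space"
  assumes "\<nu> \<in> Basis \<or> - \<nu> \<in> Basis" "x \<in> cube z h" "x \<in> neighbour z h \<nu>"
  shows "infdist x (ghost_face z h \<nu>) = 0"
  using height_bounds(1)[OF assms(1,2)] height_nonpos_neighbour[OF assms(1,3)]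
  by (simp add: infdist_ghost_face[OF assms(1,2)])

lemma power_mode_on_neighbour:
  fixes z \<nu> :: "'a::euclidean_space"
  assumes "\<nu> \<in> Basis \<or> - \<nu> \<in> Basis" "x \<in> neighbour z 1 \<nu>" "p \<ge> 1"
  shows "power_mode z \<nu> p c x = 0"
  using assms height_zero_on_interface[of \<nu> x z 1] by (auto simp: power_mode_def)

lemma distance_fun_on_cube:
  fixes z \<nu> :: "'a::euclidean_space"
  assumes "\<nu> \<in> Basis \<or> - \<nu> \<in> Basis" "x \<in> cube z h"
  shows "distance_fun z h \<nu> x = 1 * (x \<bullet> \<nu> - (z \<bullet> \<nu> - h / 2)) ^ 1"
  using assms by (simp add: distance_fun_def infdist_ghost_face)

lemma distance_fun_on_neighbour:
  fixes z \<nu> :: "'a::euclidean_space"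
  assumes "\<nu> \<in> Basis \<or> - \<nu> \<in> Basis" "x \<in> neighbour z h \<nu>"
  shows "distance_fun z h \<nu> x = 0"
  using assms height_zero_on_interface[of \<nu> x z h] by (auto simp: distance_fun_def)

lemma power_mode_in_two_cell_space:
  fixes z \<nu> :: "'a::euclidean_space"
  assumes "\<nu> \<in> Basis \<or> - \<nu> \<in> Basis" "p \<ge> 1"
  shows "power_mode z \<nu> p c \<in> two_cell_space z 1 \<nu> p"
  by (rule two_cell_space_power[OF assms(1) order_refl])
    (use assms in \<open>auto simp: power_mode_on_cube power_mode_on_neighbour\<close>)

lemma distance_fun_in_two_cell_space:
  fixes z \<nu> :: "'a::euclidean_space"
  assumes "\<nu> \<in> Basis \<or> - \<nu> \<in> Basis" "p \<ge> 1"
  shows "distance_fun z h \<nu> \<in> two_cell_space z h \<nu> p"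
  by (rule two_cell_space_power[OF assms])
    (use assms in \<open>auto simp: distance_fun_on_cube distance_fun_on_neighbour\<close>)

lemma h1_seminorm_squared:
  "(h1_seminorm C X u)\<^sup>2 = (LINT x:X|lborel. cell_grad C u x \<bullet> cell_grad C u x)"
proof -
  have "0 \<le> (LINT x:X|lborel. (norm (cell_grad C u x))\<^sup>2)"
    unfolding set_lebesgue_integral_def by (rule integral_nonneg_AE) auto
  then show ?thesis by (simp add: h1_seminorm_def power2_norm_eq_inner)
qed

lemma power_mode_energy_cube:
  fixes z \<nu> :: "'a::euclidean_space"
  assumes \<nu>: "\<nu> \<in> Basis \<or> - \<nu> \<in> Basis" and "p \<ge> 1"
  shows "(h1_seminorm (cube z 1) (cube z 1) (power_mode z \<nu> p c))\<^sup>2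
    = c\<^sup>2 * (real p)\<^sup>2 / (2 * real p - 1)"
  unfolding h1_seminorm_squared
  using integral_grad_power[OF \<nu> zero_less_one _ _ _ cube_as_slab[OF \<nu>]
      power_mode_on_cube[OF \<nu>] \<open>p \<ge> 1\<close>, of 1 z c]
  by simp

lemma power_mode_energy_physical:
  fixes z \<nu> :: "'a::euclidean_space"
  assumes \<nu>: "\<nu> \<in> Basis \<or> - \<nu> \<in> Basis" and "p \<ge> 1" and \<kappa>: "\<kappa> \<in> {0<..<1}"
  shows "(h1_seminorm (cube z 1) (physical_part z 1 \<nu> \<kappa>) (power_mode z \<nu> p c))\<^sup>2
    = c\<^sup>2 * (real p)\<^sup>2 / (2 * real p - 1) * \<kappa> ^ (2 * p - 1)"
  unfolding h1_seminorm_squared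
  using integral_grad_power[OF \<nu> zero_less_one _ _ _ physical_part_as_slab[OF \<nu>]
      power_mode_on_cube[OF \<nu>] \<open>p \<ge> 1\<close>, of "\<kappa> * 1" \<kappa> z c] \<kappa>
  by simp

lemma power_mode_ghost_energy:
  fixes z \<nu> :: "'a::euclidean_space"
  assumes "\<nu> \<in> Basis \<or> - \<nu> \<in> Basis" "p \<ge> 1"
  shows "ghost_penalty z 1 \<nu> p \<gamma> (power_mode z \<nu> p c) (power_mode z \<nu> p c) = \<gamma> * c\<^sup>2"
  using ghost_penalty_power[OF assms(1), of 1 z "power_mode z \<nu> p c" c p p \<gamma>] assms
  by (simp add: power_mode_on_cube power_mode_on_neighbour)

lemma power_mode_normalized_iff:
  fixes z \<nu> :: "'a::euclidean_space"
  assumes "\<nu> \<in> Basis \<or> - \<nu> \<in> Basis" "p \<ge> 1"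
  shows "(h1_seminorm (cube z 1) (cube z 1) (power_mode z \<nu> p c))\<^sup>2 = 1
    \<longleftrightarrow> c\<^sup>2 = (2 * real p - 1) / (real p)\<^sup>2"
  using assms(2) by (auto simp: power_mode_energy_cube[OF assms] field_simps)

text \<open>
  In units of \<open>h ^ d\<close> the energy on the slab contributes \<open>\<kappa>\<close>, each of the two consistency terms
  \<open>- \<kappa>\<close>, the Nitsche penalty \<open>\<gamma>D \<kappa>\<^sup>2\<close> and the jump of the first normal derivative \<open>\<gamma>\<close>.
\<close>

lemma two_cell_form_distance_fun:
  fixes z \<nu> :: "'a::euclidean_space"
  assumes \<nu>: "\<nu> \<in> Basis \<or> - \<nu> \<in> Basis" and "h > 0" "p \<ge> 1" and \<kappa>: "\<kappa> \<in> {0<..<1}"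
  shows "two_cell_form z h \<nu> \<kappa> p \<gamma>D \<gamma> (distance_fun z h \<nu>) (distance_fun z h \<nu>)
    = (\<gamma> - \<kappa> + \<gamma>D * \<kappa>\<^sup>2) * h ^ DIM('a)"
proof -
  let ?v = "distance_fun z h \<nu>" and ?K = "cube z h" and ?N = "neighbour z h \<nu>"
  let ?G = "cut_boundary z h \<nu> \<kappa>" and ?\<sigma> = "cut_measure z h \<nu> \<kappa>"
  let ?D = "h ^ (DIM('a) - 1)"
  have r: "0 \<le> \<kappa> * h" "\<kappa> * h \<le> h" using \<kappa> \<open>h > 0\<close> by auto
  have vK: "?v x = 1 * (x \<bullet> \<nu> - (z \<bullet> \<nu> - h / 2)) ^ 1" if "x \<in> ?K" for x
    using distance_fun_on_cube[OF \<nu> that] .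
  have "cell_grad ?N ?v x = 0" if "x \<in> ?N" for x
    using cell_grad_power[OF \<open>h > 0\<close>, of x "z - h *\<^sub>R \<nu>" ?v 0 \<nu> 0 0] that
      distance_fun_on_neighbour[OF \<nu>, of _ z h]
    by (simp add: neighbour_def)
  then have N: "(LINT x:?N|lborel. cell_grad ?N ?v x \<bullet> cell_grad ?N ?v x) = 0"
    unfolding set_lebesgue_integral_def by (intro integral_eq_zero_AE) (auto split: split_indicator)
  have P: "(LINT x:physical_part z h \<nu> \<kappa>|lborel. cell_grad ?K ?v x \<bullet> cell_grad ?K ?v x)
      = \<kappa> * h * ?D"
    by (subst integral_grad_power[OF \<nu> \<open>h > 0\<close> r _ physical_part_as_slab[OF \<nu>] vK]) auto
  have G: "?G = {x \<in> ?K. x \<bullet> \<nu> = z \<bullet> \<nu> - h / 2 + \<kappa> * h}"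
    by (auto simp: cut_boundary_def infdist_ghost_face[OF \<nu>])
  have vG: "?v x = \<kappa> * h" "normal_deriv ?K \<nu> ?v x = 1" if "x \<in> ?G" for x
    using that normal_deriv_power[OF signed_basis_inner_self[OF \<nu>] \<open>h > 0\<close> _ vK, of x]
    by (auto simp: G vK)
  have GI: "(LINT x:?G|?\<sigma>. f x) = C * ?D" if "\<And>x. x \<in> ?G \<Longrightarrow> f x = C" for f C
    by (rule integral_const_on_plane_section[OF \<nu> r refl G that])
  have "(LINT x:?G|?\<sigma>. normal_deriv ?K \<nu> ?v x * ?v x) = \<kappa> * h * ?D"
    "(LINT x:?G|?\<sigma>. ?v x * normal_deriv ?K \<nu> ?v x) = \<kappa> * h * ?D"
    "(LINT x:?G|?\<sigma>. ?v x * ?v x) = (\<kappa> * h)\<^sup>2 * ?D"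
    by (rule GI; simp add: vG power2_eq_square)+
  moreover have "ghost_penalty z h \<nu> p \<gamma> ?v ?v = \<gamma> * (h * ?D)"
    using ghost_penalty_power[OF \<nu> \<open>h > 0\<close> vK distance_fun_on_neighbour[OF \<nu>], of p \<gamma>] \<open>p \<ge> 1\<close>
    by simp
  ultimately have "two_cell_form z h \<nu> \<kappa> p \<gamma>D \<gamma> ?v ?v
      = \<kappa> * h * ?D - \<kappa> * h * ?D - \<kappa> * h * ?D + \<gamma>D / h * ((\<kappa> * h)\<^sup>2 * ?D) + \<gamma> * (h * ?D)"
    unfolding two_cell_form_def Let_def N P by simp
  also have "\<dots> = (\<gamma> - \<kappa> + \<gamma>D * \<kappa>\<^sup>2) * (h * ?D)"
    using \<open>h > 0\<close> by (simp add: field_simps power2_eq_square)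
  also have "h * ?D = h ^ DIM('a)"
    by (simp add: power_eq_if[of h "DIM('a)"])
  finally show ?thesis .
qed

section \<open>The coercivity floor\<close>

lemma critical_cut_value:
  fixes \<gamma>D :: real
  assumes "\<gamma>D > 0"
  shows "1 / (2 * \<gamma>D) * (1 - \<gamma>D * (1 / (2 * \<gamma>D))) = 1 / (4 * \<gamma>D)"
  using assms by (simp add: field_simps)

text \<open>
  Completing the square: \<open>\<gamma>D (1 / (4 \<gamma>D) - \<kappa> (1 - \<gamma>D \<kappa>)) = (\<gamma>D \<kappa> - 1 / 2)\<^sup>2\<close>. The hypothesis on
  \<open>\<gamma>D\<close> places the critical point inside the open unit interval.
\<close>

lemma critical_cut_is_arg_max:
  fixes \<gamma>D :: real
  assumes "\<gamma>D > 1 / 2"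
  shows "is_arg_max (\<lambda>\<kappa>. \<kappa> * (1 - \<gamma>D * \<kappa>)) (\<lambda>\<kappa>. \<kappa> \<in> {0<..<1}) (1 / (2 * \<gamma>D))"
proof -
  have "\<kappa> * (1 - \<gamma>D * \<kappa>) \<le> 1 / (4 * \<gamma>D)" for \<kappa>
  proof -
    have "\<gamma>D * (1 / (4 * \<gamma>D) - \<kappa> * (1 - \<gamma>D * \<kappa>)) = (\<gamma>D * \<kappa> - 1 / 2)\<^sup>2"
      using assms by (simp add: field_simps power2_eq_square)
    then have "0 \<le> \<gamma>D * (1 / (4 * \<gamma>D) - \<kappa> * (1 - \<gamma>D * \<kappa>))" by simp
    then show ?thesis using assms by (simp add: zero_le_mult_iff)
  qed
  then show ?thesis
    using assms critical_cut_value[of \<gamma>D] by (auto simp: is_arg_max_def not_less)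
qed

text \<open>
  The form is tested with the distance function at the critical cut fraction \<open>\<kappa> = 1 / (2 \<gamma>D)\<close>; this
  function has degree at most \<open>1\<close> in each variable and so belongs to the discrete space of every degree \<open>p \<ge> 1\<close>.
\<close>

lemma cut_uniformly_nonneg_floor:
  fixes z \<nu> :: "'a::euclidean_space"
  assumes \<nu>: "\<nu> \<in> Basis \<or> - \<nu> \<in> Basis" and "h > 0" "p \<ge> 1" "\<gamma>D > 1 / 2"
    and nonneg: "cut_uniformly_nonneg z h \<nu> p \<gamma>D \<gamma>"
  shows "\<gamma> \<ge> 1 / (4 * \<gamma>D)"
proof -
  define \<kappa> where "\<kappa> = 1 / (2 * \<gamma>D)"
  have \<kappa>: "\<kappa> \<in> {0<..<1}" using \<open>\<gamma>D > 1 / 2\<close> by (simp add: \<kappa>_def)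
  have "0 \<le> two_cell_form z h \<nu> \<kappa> p \<gamma>D \<gamma> (distance_fun z h \<nu>) (distance_fun z h \<nu>)"
    using nonneg \<kappa> distance_fun_in_two_cell_space[OF \<nu> \<open>p \<ge> 1\<close>, of z h]
    unfolding cut_uniformly_nonneg_def by blast
  then have "0 \<le> (\<gamma> - \<kappa> + \<gamma>D * \<kappa>\<^sup>2) * h ^ DIM('a)"
    unfolding two_cell_form_distance_fun[OF \<nu> \<open>h > 0\<close> \<open>p \<ge> 1\<close> \<kappa>] .
  then have "0 \<le> \<gamma> - \<kappa> + \<gamma>D * \<kappa>\<^sup>2"
    using zero_less_power[OF \<open>h > 0\<close>, of "DIM('a)"] by (simp add: zero_le_mult_iff)
  then have "\<kappa> * (1 - \<gamma>D * \<kappa>) \<le> \<gamma>"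
    by (simp add: power2_eq_square algebra_simps)
  then show ?thesis
    using critical_cut_value[of \<gamma>D] \<open>\<gamma>D > 1 / 2\<close> by (simp add: \<kappa>_def)
qed

section \<open>The visibility scale and its incompatibility with the floor\<close>

text \<open>
  A positive weight that depends on \<open>p\<close> may be cancelled, since the constant is the same for all \<open>p\<close>. It
  serves to divide ghost and physical energy of the mode by the squared normalization factor.
\<close>

lemma lesssim_cancel:
  fixes f g f' g' w :: "nat \<Rightarrow> real"
  assumes "\<And>p. p \<ge> 1 \<Longrightarrow> w p > 0"
    and "\<And>p. p \<ge> 1 \<Longrightarrow> f p = f' p * w p" "\<And>p. p \<ge> 1 \<Longrightarrow> g p = g' p * w p"
  shows "f \<lesssim> g \<longleftrightarrow> f' \<lesssim> g'"
proof -
  have "f p \<le> M * g p \<longleftrightarrow> f' p \<le> M * g' p" if "p \<ge> 1" for p M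
    using mult_le_cancel_right_pos[OF assms(1)[OF that], of "f' p" "M * g' p"]
      assms(2,3)[OF that] by (simp add: mult.assoc)
  then show ?thesis by (simp add: lesssim_def)
qed

text \<open>
  For every normalized family of factors \<open>c\<close>, ghost and physical energy of the mode are \<open>(c p)\<^sup>2\<close> times
  the weight and times \<open>\<gamma>\<^sub>v\<^sub>i\<^sub>s\<close>. Since the definition quantifies universally over such families, one
  direction needs a normalized family to exist.
\<close>

lemma visibility_scale_iff:
  fixes z \<nu> :: "'a::euclidean_space"
  assumes \<nu>: "\<nu> \<in> Basis \<or> - \<nu> \<in> Basis" and \<kappa>: "\<kappa> \<in> {0<..<1}"
  shows "visibility_scale z \<nu> \<kappa> g
    \<longleftrightarrow> g \<simeq> (\<lambda>p. (real p)\<^sup>2 / (2 * real p - 1) * \<kappa> ^ (2 * p - 1))"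
    (is "_ \<longleftrightarrow> g \<simeq> ?vis")
proof -
  let ?ghost = "\<lambda>c p. ghost_penalty z 1 \<nu> p (g p) (power_mode z \<nu> p (c p)) (power_mode z \<nu> p (c p))"
  let ?phys = "\<lambda>c p. (h1_seminorm (cube z 1) (physical_part z 1 \<nu> \<kappa>) (power_mode z \<nu> p (c p)))\<^sup>2"
  let ?unit = "\<lambda>c. \<forall>p\<ge>1. (h1_seminorm (cube z 1) (cube z 1) (power_mode z \<nu> p (c p)))\<^sup>2 = 1"
  have unit: "?unit c \<longleftrightarrow> (\<forall>p\<ge>1. (c p)\<^sup>2 = (2 * real p - 1) / (real p)\<^sup>2)" for c
    by (simp add: power_mode_normalized_iff[OF \<nu>])
  have iff: "?ghost c \<simeq> ?phys c \<longleftrightarrow> g \<simeq> ?vis" if "?unit c" for c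
  proof -
    have w: "(c p)\<^sup>2 > 0" if "p \<ge> 1" for p
      using \<open>?unit c\<close>[unfolded unit] that by simp
    have gh: "?ghost c p = g p * (c p)\<^sup>2" and ph: "?phys c p = ?vis p * (c p)\<^sup>2" if "p \<ge> 1" for p
      using that by (simp_all add: power_mode_ghost_energy[OF \<nu>]
          power_mode_energy_physical[OF \<nu> _ \<kappa>])
    have "?ghost c \<lesssim> ?phys c \<longleftrightarrow> g \<lesssim> ?vis"
      by (rule lesssim_cancel[where w = "\<lambda>p. (c p)\<^sup>2"]; rule w gh ph; assumption)
    moreover have "?phys c \<lesssim> ?ghost c \<longleftrightarrow> ?vis \<lesssim> g"
      by (rule lesssim_cancel[where w = "\<lambda>p. (c p)\<^sup>2"]; rule w gh ph; assumption)
    ultimately show ?thesis by (simp add: simeq_def)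
  qed
  have ex: "?unit (\<lambda>p. sqrt ((2 * real p - 1) / (real p)\<^sup>2))"
    unfolding unit by simp
  show ?thesis
    unfolding visibility_scale_def
  proof (intro iffI allI impI)
    assume "\<forall>c. ?unit c \<longrightarrow> ?ghost c \<simeq> ?phys c"
    from this[rule_format, OF ex[rule_format]] show "g \<simeq> ?vis"
      by (simp only: iff[OF ex])
  next
    fix c assume "g \<simeq> ?vis" and "?unit c"
    then show "?ghost c \<simeq> ?phys c" by (simp only: iff)
  qed
qed

lemma nitsche_floor_order:
  assumes "\<gamma>D \<simeq> (\<lambda>p. (real p)\<^sup>2)"
  shows "(\<lambda>p. 1 / (4 * \<gamma>D p)) \<simeq> (\<lambda>p. 1 / (real p)\<^sup>2)"
proof -
  obtain M L where M: "M > 0" "\<And>p. p \<ge> 1 \<Longrightarrow> \<gamma>D p \<le> M * (real p)\<^sup>2"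
    and L: "L > 0" "\<And>p. p \<ge> 1 \<Longrightarrow> (real p)\<^sup>2 \<le> L * \<gamma>D p"
    using assms by (auto simp: simeq_def lesssim_def)
  have pos: "(real p)\<^sup>2 > 0 \<and> \<gamma>D p > 0" if "p \<ge> 1" for p
  proof -
    have "(real p)\<^sup>2 > 0" using that by simp
    with L(1) L(2)[OF that] show ?thesis by (smt (verit) mult_nonneg_nonpos)
  qed
  have "1 / (4 * \<gamma>D p) \<le> L / 4 * (1 / (real p)\<^sup>2)"
    and "1 / (real p)\<^sup>2 \<le> 4 * M * (1 / (4 * \<gamma>D p))" if "p \<ge> 1" for p
    using pos[OF that] L(2)[OF that] M(2)[OF that] by (simp_all add: field_simps)
  then show ?thesis
    unfolding simeq_def lesssim_def using L(1) M(1)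
    by (meson divide_pos_pos mult_pos_pos zero_less_numeral)
qed

text \<open>
  With \<open>y\<close> the cube root of \<open>\<kappa>\<close>, the sequence is dominated by \<open>p ^ 3 * \<kappa> ^ p = (p * y ^ p) ^ 3\<close>, and
  \<open>p * y ^ p\<close> tends to zero as \<open>y < 1\<close>.
\<close>

lemma cubic_times_power_tendsto_0:
  fixes \<kappa> :: real
  assumes "\<kappa> \<in> {0<..<1}"
  shows "(\<lambda>p. real p ^ 3 * \<kappa> ^ (2 * p - 1)) \<longlonglongrightarrow> 0"
proof -
  define y where "y = root 3 \<kappa>"
  have y: "0 < y" "y < 1" "y ^ 3 = \<kappa>"
    using assms by (simp_all add: y_def real_root_lt_1_iff odd_real_root_pow)
  have "(\<lambda>p. (real p * y ^ p) ^ 3) \<longlonglongrightarrow> 0 ^ 3"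
    by (intro tendsto_power powser_times_n_limit_0) (use y in auto)
  then have lim: "(\<lambda>p. real p ^ 3 * \<kappa> ^ p) \<longlonglongrightarrow> 0"
    by (simp add: power_mult_distrib flip: y(3) power_mult) (simp add: mult.commute)
  have "0 \<le> real p ^ 3 * \<kappa> ^ (2 * p - 1)"
    "real p ^ 3 * \<kappa> ^ (2 * p - 1) \<le> real p ^ 3 * \<kappa> ^ p" if "p \<ge> 1" for p
    using that assms by (auto intro!: mult_left_mono power_decreasing)
  then show ?thesis
    by (intro tendsto_sandwich[OF _ _ tendsto_const lim] eventually_sequentiallyI[of 1])
qed

text \<open>
  The quotient is \<open>4 \<gamma>vis \<gamma>D\<close>, and \<open>p\<^sup>2 / (2 p - 1) \<le> p\<close> bounds it by a constant times
  \<open>p * \<kappa> ^ (2 p - 1) * p\<^sup>2\<close>. The lower halves of the two order relations give the signs of \<open>\<gamma>D\<close> and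
  \<open>\<gamma>vis\<close>, which the multiplication of bounds and the squeeze to zero require.
\<close>

lemma visibility_floor_ratio:
  assumes \<gamma>D: "\<gamma>D \<simeq> (\<lambda>p. (real p)\<^sup>2)" and \<kappa>: "\<kappa> \<in> {0<..<1}"
    and \<gamma>vis: "\<gamma>vis \<simeq> (\<lambda>p. (real p)\<^sup>2 / (2 * real p - 1) * \<kappa> ^ (2 * p - 1))"
  shows "(\<lambda>p. \<gamma>vis p / (1 / (4 * \<gamma>D p))) \<lesssim> (\<lambda>p. real p ^ 3 * \<kappa> ^ (2 * p - 1))"
    and "(\<lambda>p. \<gamma>vis p / (1 / (4 * \<gamma>D p))) \<longlonglongrightarrow> 0"
proof -
  let ?V = "\<lambda>p. (real p)\<^sup>2 / (2 * real p - 1) * \<kappa> ^ (2 * p - 1)"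
  obtain M L where M: "M > 0" "\<And>p. p \<ge> 1 \<Longrightarrow> \<gamma>D p \<le> M * (real p)\<^sup>2"
    and L: "L > 0" "\<And>p. p \<ge> 1 \<Longrightarrow> (real p)\<^sup>2 \<le> L * \<gamma>D p"
    using \<gamma>D by (auto simp: simeq_def lesssim_def)
  obtain M' L' where M': "M' > 0" "\<And>p. p \<ge> 1 \<Longrightarrow> \<gamma>vis p \<le> M' * ?V p"
    and L': "L' > 0" "\<And>p. p \<ge> 1 \<Longrightarrow> ?V p \<le> L' * \<gamma>vis p"
    using \<gamma>vis unfolding simeq_def lesssim_def by blast
  have bounds: "0 \<le> \<gamma>vis p / (1 / (4 * \<gamma>D p))"
    "\<gamma>vis p / (1 / (4 * \<gamma>D p)) \<le> 4 * M * M' * (real p ^ 3 * \<kappa> ^ (2 * p - 1))" if "p \<ge> 1" for p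
  proof -
    have "0 \<le> L * \<gamma>D p" using L(2)[OF that] by (meson order_trans zero_le_power2)
    then have D0: "0 \<le> \<gamma>D p" using L(1) by (simp add: zero_le_mult_iff)
    have V0: "0 \<le> ?V p" using that \<kappa> by simp
    then have "0 \<le> L' * \<gamma>vis p" using L'(2)[OF that] by linarith
    then have v0: "0 \<le> \<gamma>vis p" using L'(1) by (simp add: zero_le_mult_iff)
    show "0 \<le> \<gamma>vis p / (1 / (4 * \<gamma>D p))" using D0 v0 by simp
    have "\<gamma>vis p / (1 / (4 * \<gamma>D p)) = 4 * (\<gamma>vis p * \<gamma>D p)" by simp
    also have "\<gamma>vis p * \<gamma>D p \<le> (M' * (real p * \<kappa> ^ (2 * p - 1))) * (M * (real p)\<^sup>2)"
    proof (rule mult_mono[OF _ M(2)[OF that] _ D0])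
      have "?V p \<le> real p * \<kappa> ^ (2 * p - 1)"
        using that \<kappa> by (intro mult_right_mono) (auto simp: field_simps power2_eq_square)
      then have "M' * ?V p \<le> M' * (real p * \<kappa> ^ (2 * p - 1))"
        using M'(1) by (intro mult_left_mono) auto
      with M'(2)[OF that] show "\<gamma>vis p \<le> M' * (real p * \<kappa> ^ (2 * p - 1))" by linarith
      show "0 \<le> M' * (real p * \<kappa> ^ (2 * p - 1))" using M'(1) \<kappa> by simp
    qed
    finally show "\<gamma>vis p / (1 / (4 * \<gamma>D p)) \<le> 4 * M * M' * (real p ^ 3 * \<kappa> ^ (2 * p - 1))"
      by (simp add: mult_ac power2_eq_square power3_eq_cube)
  qed
  show "(\<lambda>p. \<gamma>vis p / (1 / (4 * \<gamma>D p))) \<lesssim> (\<lambda>p. real p ^ 3 * \<kappa> ^ (2 * p - 1))"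
    unfolding lesssim_def using bounds(2) M(1) M'(1)
    by (intro exI[of _ "4 * M * M'"]) auto
  show "(\<lambda>p. \<gamma>vis p / (1 / (4 * \<gamma>D p))) \<longlonglongrightarrow> 0"
  proof (rule tendsto_sandwich[OF _ _ tendsto_const])
    show "(\<lambda>p. 4 * M * M' * (real p ^ 3 * \<kappa> ^ (2 * p - 1))) \<longlonglongrightarrow> 0"
      by (rule tendsto_mult_right_zero[OF cubic_times_power_tendsto_0[OF \<kappa>]])
  qed (use bounds in \<open>auto intro: eventually_sequentiallyI[of 1]\<close>)
qed

text \<open>
  Once \<open>\<gamma>D p > 1 / 2\<close>, uniform nonnegativity forces \<open>\<gamma> \<ge> 1 / (4 \<gamma>D p)\<close>, and \<open>\<gamma> \<le> B \<gamma>vis p\<close> would then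
  keep the quotient of visibility scale and floor at least \<open>1 / B\<close>.
\<close>

lemma no_multiplier_reaches_visibility:
  fixes z \<nu> :: "'a::euclidean_space"
  assumes \<nu>: "\<nu> \<in> Basis \<or> - \<nu> \<in> Basis" and "h > 0"
    and \<gamma>D: "\<gamma>D \<simeq> (\<lambda>p. (real p)\<^sup>2)"
    and ratio: "(\<lambda>p. \<gamma>vis p / (1 / (4 * \<gamma>D p))) \<longlonglongrightarrow> 0" and "B > 0"
  shows "\<forall>\<^sub>F p in sequentially.
    \<not> (\<exists>\<gamma>\<in>{0<..1}. \<gamma> \<le> B * \<gamma>vis p \<and> cut_uniformly_nonneg z h \<nu> p (\<gamma>D p) \<gamma>)"
proof -
  obtain L where L: "L > 0" "\<And>p. p \<ge> 1 \<Longrightarrow> (real p)\<^sup>2 \<le> L * \<gamma>D p"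
    using \<gamma>D by (auto simp: simeq_def lesssim_def)
  have "\<forall>\<^sub>F p in sequentially. \<gamma>vis p / (1 / (4 * \<gamma>D p)) < 1 / B"
    using ratio \<open>B > 0\<close> by (intro order_tendstoD(2)) auto
  moreover have "\<forall>\<^sub>F p in sequentially. real p > L"
    using filterlim_real_sequentially by (simp add: filterlim_at_top_dense)
  moreover have "\<forall>\<^sub>F p in sequentially. p \<ge> (1::nat)" by (rule eventually_ge_at_top)
  ultimately show ?thesis
  proof eventually_elim
    case (elim p)
    \<comment> \<open>As \<open>p > L\<close>, the lower bound \<open>p\<^sup>2 \<le> L \<gamma>D p\<close> pushes \<open>\<gamma>D p\<close> beyond \<open>1 / 2\<close>.\<close>
    have "L * 1 < real p * real p"
      using elim(2,3) L(1) by (intro mult_less_le_imp_less) auto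
    also have "\<dots> \<le> L * \<gamma>D p" using L(2)[OF elim(3)] by (simp add: power2_eq_square)
    finally have D: "\<gamma>D p > 1" using L(1) by simp
    have "\<not> cut_uniformly_nonneg z h \<nu> p (\<gamma>D p) \<gamma>" if "\<gamma> \<le> B * \<gamma>vis p" for \<gamma>
    proof
      assume "cut_uniformly_nonneg z h \<nu> p (\<gamma>D p) \<gamma>"
      then have "1 / (4 * \<gamma>D p) \<le> \<gamma>"
        using D by (intro cut_uniformly_nonneg_floor[OF \<nu> \<open>h > 0\<close> elim(3)]) auto
      with that have "1 / (4 * \<gamma>D p) \<le> B * \<gamma>vis p" by simp
      with elim(1) D \<open>B > 0\<close> show False by (simp add: field_simps)
    qed
    then show ?case by blast
  qed
qed

theorem proposition4:
  fixes z \<nu> :: "'a::euclidean_space" and h :: real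
  assumes "\<nu> \<in> Basis \<or> - \<nu> \<in> Basis" and "h > 0"
  shows
    "(\<comment> \<open>(i) the mode and its energies\<close>
      (\<forall>p\<ge>1. \<forall>c. power_mode z \<nu> p c \<in> two_cell_space z 1 \<nu> p \<and>
         ((h1_seminorm (cube z 1) (cube z 1) (power_mode z \<nu> p c))\<^sup>2 = 1
            \<longleftrightarrow> c\<^sup>2 = (2 * real p - 1) / (real p)\<^sup>2)) \<and>
      (\<forall>p\<ge>1. \<forall>c. \<forall>\<kappa>\<in>{0<..<1}. \<forall>\<gamma>>0. c\<^sup>2 = (2 * real p - 1) / (real p)\<^sup>2 \<longrightarrow>
         (let phys = (h1_seminorm (cube z 1) (physical_part z 1 \<nu> \<kappa>) (power_mode z \<nu> p c))\<^sup>2;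
              ghost = ghost_penalty z 1 \<nu> p \<gamma> (power_mode z \<nu> p c) (power_mode z \<nu> p c);
              \<gamma>vis = (real p)\<^sup>2 / (2 * real p - 1) * \<kappa> ^ (2 * p - 1)
          in phys = \<kappa> ^ (2 * p - 1) \<and> ghost = \<gamma> * c\<^sup>2 \<and>
             (\<forall>\<rho>>0. (ghost \<le> \<rho> * phys \<longleftrightarrow> \<gamma> \<le> \<rho> * \<gamma>vis) \<and>
                     (ghost \<ge> \<rho> * phys \<longleftrightarrow> \<gamma> \<ge> \<rho> * \<gamma>vis)))) \<and>
      (\<forall>\<kappa>\<in>{0<..<1}. \<forall>g. visibility_scale z \<nu> \<kappa> g \<longleftrightarrow>
         g \<simeq> (\<lambda>p. (real p)\<^sup>2 / (2 * real p - 1) * \<kappa> ^ (2 * p - 1)))) \<and>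
     (\<comment> \<open>(ii) coercivity obstruction\<close>
      distance_fun z h \<nu> \<in> two_cell_space z h \<nu> 1 \<and>
      (\<forall>p\<ge>1. \<forall>\<gamma>\<in>{0<..1}. \<forall>\<gamma>D. \<forall>\<kappa>\<in>{0<..<1}.
         two_cell_form z h \<nu> \<kappa> p \<gamma>D \<gamma> (distance_fun z h \<nu>) (distance_fun z h \<nu>)
           = (\<gamma> - \<kappa> + \<gamma>D * \<kappa>\<^sup>2) * h ^ DIM('a)) \<and>
      (\<forall>\<gamma>D>1/2.
         is_arg_max (\<lambda>\<kappa>. \<kappa> * (1 - \<gamma>D * \<kappa>)) (\<lambda>\<kappa>. \<kappa> \<in> {0<..<1}) (1 / (2 * \<gamma>D)) \<and>
         1 / (2 * \<gamma>D) * (1 - \<gamma>D * (1 / (2 * \<gamma>D))) = 1 / (4 * \<gamma>D) \<and>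
         (\<forall>p\<ge>1. \<forall>\<gamma>\<in>{0<..1}. cut_uniformly_nonneg z h \<nu> p \<gamma>D \<gamma> \<longrightarrow> \<gamma> \<ge> 1 / (4 * \<gamma>D))) \<and>
      (\<forall>\<gamma>D. \<gamma>D \<simeq> (\<lambda>p. (real p)\<^sup>2) \<longrightarrow> (\<lambda>p. 1 / (4 * \<gamma>D p)) \<simeq> (\<lambda>p. 1 / (real p)\<^sup>2))) \<and>
     (\<comment> \<open>(iii) incompatibility\<close>
      \<forall>\<gamma>D \<gamma>vis. \<forall>\<kappa>\<in>{0<..<1}. \<gamma>D \<simeq> (\<lambda>p. (real p)\<^sup>2) \<and> visibility_scale z \<nu> \<kappa> \<gamma>vis \<longrightarrow>
         (\<lambda>p. \<gamma>vis p / (1 / (4 * \<gamma>D p))) \<lesssim> (\<lambda>p. real p ^ 3 * \<kappa> ^ (2 * p - 1)) \<and>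
         (\<lambda>p. real p ^ 3 * \<kappa> ^ (2 * p - 1)) \<longlonglongrightarrow> 0 \<and>
         (\<lambda>p. \<gamma>vis p / (1 / (4 * \<gamma>D p))) \<longlonglongrightarrow> 0 \<and>
         (\<forall>B>0. \<forall>\<^sub>F p in sequentially.
            \<not> (\<exists>\<gamma>\<in>{0<..1}. \<gamma> \<le> B * \<gamma>vis p \<and> cut_uniformly_nonneg z h \<nu> p (\<gamma>D p) \<gamma>)))"
proof (intro conjI)
  note \<nu> = assms(1)
  show "\<forall>p\<ge>1. \<forall>c. power_mode z \<nu> p c \<in> two_cell_space z 1 \<nu> p \<and>
         ((h1_seminorm (cube z 1) (cube z 1) (power_mode z \<nu> p c))\<^sup>2 = 1
            \<longleftrightarrow> c\<^sup>2 = (2 * real p - 1) / (real p)\<^sup>2)"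
    by (simp add: power_mode_in_two_cell_space[OF \<nu>] power_mode_normalized_iff[OF \<nu>])
  show "\<forall>p\<ge>1. \<forall>c. \<forall>\<kappa>\<in>{0<..<1}. \<forall>\<gamma>>0. c\<^sup>2 = (2 * real p - 1) / (real p)\<^sup>2 \<longrightarrow>
         (let phys = (h1_seminorm (cube z 1) (physical_part z 1 \<nu> \<kappa>) (power_mode z \<nu> p c))\<^sup>2;
              ghost = ghost_penalty z 1 \<nu> p \<gamma> (power_mode z \<nu> p c) (power_mode z \<nu> p c);
              \<gamma>vis = (real p)\<^sup>2 / (2 * real p - 1) * \<kappa> ^ (2 * p - 1)
          in phys = \<kappa> ^ (2 * p - 1) \<and> ghost = \<gamma> * c\<^sup>2 \<and>
             (\<forall>\<rho>>0. (ghost \<le> \<rho> * phys \<longleftrightarrow> \<gamma> \<le> \<rho> * \<gamma>vis) \<and>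
                     (ghost \<ge> \<rho> * phys \<longleftrightarrow> \<gamma> \<ge> \<rho> * \<gamma>vis)))"
  proof (intro allI ballI impI)
    fix p :: nat and c \<kappa> \<gamma> :: real
    assume p: "1 \<le> p" and \<kappa>: "\<kappa> \<in> {0<..<1}" and c: "c\<^sup>2 = (2 * real p - 1) / (real p)\<^sup>2"
    define V where "V = (real p)\<^sup>2 / (2 * real p - 1) * \<kappa> ^ (2 * p - 1)"
    have c0: "c\<^sup>2 > 0" and V: "\<kappa> ^ (2 * p - 1) = V * c\<^sup>2"
      using p by (simp_all add: c V_def)
    have "(h1_seminorm (cube z 1) (physical_part z 1 \<nu> \<kappa>) (power_mode z \<nu> p c))\<^sup>2 = V * c\<^sup>2"
      by (simp add: power_mode_energy_physical[OF \<nu> p \<kappa>] V_def)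
    then have phys: "(h1_seminorm (cube z 1) (physical_part z 1 \<nu> \<kappa>) (power_mode z \<nu> p c))\<^sup>2
        = \<kappa> ^ (2 * p - 1)"
      by (simp only: V)
    have "\<gamma> * c\<^sup>2 \<le> \<rho> * \<kappa> ^ (2 * p - 1) \<longleftrightarrow> \<gamma> \<le> \<rho> * V"
      "\<rho> * \<kappa> ^ (2 * p - 1) \<le> \<gamma> * c\<^sup>2 \<longleftrightarrow> \<rho> * V \<le> \<gamma>" for \<rho>
      unfolding V mult.assoc[symmetric] by (simp_all only: mult_le_cancel_right_pos[OF c0])
    then show "let phys = (h1_seminorm (cube z 1) (physical_part z 1 \<nu> \<kappa>) (power_mode z \<nu> p c))\<^sup>2;
              ghost = ghost_penalty z 1 \<nu> p \<gamma> (power_mode z \<nu> p c) (power_mode z \<nu> p c);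
              \<gamma>vis = (real p)\<^sup>2 / (2 * real p - 1) * \<kappa> ^ (2 * p - 1)
          in phys = \<kappa> ^ (2 * p - 1) \<and> ghost = \<gamma> * c\<^sup>2 \<and>
             (\<forall>\<rho>>0. (ghost \<le> \<rho> * phys \<longleftrightarrow> \<gamma> \<le> \<rho> * \<gamma>vis) \<and>
                     (ghost \<ge> \<rho> * phys \<longleftrightarrow> \<gamma> \<ge> \<rho> * \<gamma>vis))"
      unfolding Let_def V_def[symmetric] phys power_mode_ghost_energy[OF \<nu> p] by blast
  qed
  show "\<forall>\<kappa>\<in>{0<..<1}. \<forall>g. visibility_scale z \<nu> \<kappa> g \<longleftrightarrow>
         g \<simeq> (\<lambda>p. (real p)\<^sup>2 / (2 * real p - 1) * \<kappa> ^ (2 * p - 1))"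
    by (intro ballI allI visibility_scale_iff[OF \<nu>])
  show "distance_fun z h \<nu> \<in> two_cell_space z h \<nu> 1"
    by (rule distance_fun_in_two_cell_space[OF \<nu> order_refl])
  show "\<forall>p\<ge>1. \<forall>\<gamma>\<in>{0<..1}. \<forall>\<gamma>D. \<forall>\<kappa>\<in>{0<..<1}.
         two_cell_form z h \<nu> \<kappa> p \<gamma>D \<gamma> (distance_fun z h \<nu>) (distance_fun z h \<nu>)
           = (\<gamma> - \<kappa> + \<gamma>D * \<kappa>\<^sup>2) * h ^ DIM('a)"
    by (intro allI impI ballI two_cell_form_distance_fun[OF assms])
  show "\<forall>\<gamma>D>1/2.
         is_arg_max (\<lambda>\<kappa>. \<kappa> * (1 - \<gamma>D * \<kappa>)) (\<lambda>\<kappa>. \<kappa> \<in> {0<..<1}) (1 / (2 * \<gamma>D)) \<and>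
         1 / (2 * \<gamma>D) * (1 - \<gamma>D * (1 / (2 * \<gamma>D))) = 1 / (4 * \<gamma>D) \<and>
         (\<forall>p\<ge>1. \<forall>\<gamma>\<in>{0<..1}. cut_uniformly_nonneg z h \<nu> p \<gamma>D \<gamma> \<longrightarrow> \<gamma> \<ge> 1 / (4 * \<gamma>D))"
    by (intro allI impI conjI ballI critical_cut_is_arg_max critical_cut_value
        cut_uniformly_nonneg_floor[OF assms]) simp_all
  show "\<forall>\<gamma>D. \<gamma>D \<simeq> (\<lambda>p. (real p)\<^sup>2) \<longrightarrow> (\<lambda>p. 1 / (4 * \<gamma>D p)) \<simeq> (\<lambda>p. 1 / (real p)\<^sup>2)"
    by (intro allI impI nitsche_floor_order)
  show "\<forall>\<gamma>D \<gamma>vis. \<forall>\<kappa>\<in>{0<..<1}. \<gamma>D \<simeq> (\<lambda>p. (real p)\<^sup>2) \<and> visibility_scale z \<nu> \<kappa> \<gamma>vis \<longrightarrow>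
         (\<lambda>p. \<gamma>vis p / (1 / (4 * \<gamma>D p))) \<lesssim> (\<lambda>p. real p ^ 3 * \<kappa> ^ (2 * p - 1)) \<and>
         (\<lambda>p. real p ^ 3 * \<kappa> ^ (2 * p - 1)) \<longlonglongrightarrow> 0 \<and>
         (\<lambda>p. \<gamma>vis p / (1 / (4 * \<gamma>D p))) \<longlonglongrightarrow> 0 \<and>
         (\<forall>B>0. \<forall>\<^sub>F p in sequentially.
            \<not> (\<exists>\<gamma>\<in>{0<..1}. \<gamma> \<le> B * \<gamma>vis p \<and> cut_uniformly_nonneg z h \<nu> p (\<gamma>D p) \<gamma>))"
  proof (intro allI ballI impI, elim conjE)
    fix \<gamma>D \<gamma>vis :: "nat \<Rightarrow> real" and \<kappa> :: real
    assume \<kappa>: "\<kappa> \<in> {0<..<1}" and \<gamma>D: "\<gamma>D \<simeq> (\<lambda>p. (real p)\<^sup>2)" and "visibility_scale z \<nu> \<kappa> \<gamma>vis"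
    then have "\<gamma>vis \<simeq> (\<lambda>p. (real p)\<^sup>2 / (2 * real p - 1) * \<kappa> ^ (2 * p - 1))"
      by (simp only: visibility_scale_iff[OF \<nu> \<kappa>])
    note ratio = visibility_floor_ratio[OF \<gamma>D \<kappa> this]
    show "(\<lambda>p. \<gamma>vis p / (1 / (4 * \<gamma>D p))) \<lesssim> (\<lambda>p. real p ^ 3 * \<kappa> ^ (2 * p - 1)) \<and>
         (\<lambda>p. real p ^ 3 * \<kappa> ^ (2 * p - 1)) \<longlonglongrightarrow> 0 \<and>
         (\<lambda>p. \<gamma>vis p / (1 / (4 * \<gamma>D p))) \<longlonglongrightarrow> 0 \<and>
         (\<forall>B>0. \<forall>\<^sub>F p in sequentially.
            \<not> (\<exists>\<gamma>\<in>{0<..1}. \<gamma> \<le> B * \<gamma>vis p \<and> cut_uniformly_nonneg z h \<nu> p (\<gamma>D p) \<gamma>))"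
      using ratio cubic_times_power_tendsto_0[OF \<kappa>]
        no_multiplier_reaches_visibility[OF assms \<gamma>D ratio(2)]
      by (intro conjI allI impI)
  qed
qed

end
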